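(* Let $d\ge 1$, $\phi:\{-1,1\}^d\to\{-1,1\}$, let $\varepsilon=(\varepsilon_n)_{n\in\mathbf{Z}}$ be a coin-tossing sequence, $H_n=\phi(\varepsilon_{n-d},\dots,\varepsilon_{n-1})$ and $\Phi(\varepsilon)=H\varepsilon=(H_n\varepsilon_n)_{n\in\mathbf{Z}}$. Let $F:\{-1,1\}^{-\mathbf{N}}\to\mathcal{C}$ be the measurable map described in the context. Then for every $n\in\mathbf{Z}$, almost surely, the conditional law of $(\varepsilon_{n-d+1},\dots,\varepsilon_n)$ given $\Phi(\varepsilon)$ is the uniform law on the set $F((H\varepsilon)_{n]})$.
   Context: $-\mathbf{N}=\{\dots,-2,-1,0\}$. A coin-tossing sequence is a family of independent random variables, each of law $(\delta_{-1}+\delta_1)/2$. For a sequence $x\in\{-1,1\}^{\mathbf{Z}}$, $x_{n]}=(x_{n+k})_{k\in-\mathbf{N}}$. Let $E_d=\{-1,1\}^d$ and, for $\alpha\in\{-1,1\}$ (also written $-,+$), $f_\alpha:E_d\to E_d$, $f_\alpha(x_1,\dots,x_d)=(x_2,\dots,x_d,\alpha\,\phi(x_1,\dots,x_d))$. Elements $a,b\in E_d$ are accordable if some composite $f_{\alpha_l}\circ\cdots\circ f_{\alpha_1}$ ($\alpha_i\in\{-1,1\}$) takes the same value at $a$ and $b$. $M$ denotes the maximal number of pairwise non-accordable elements of $E_d$. On the set $\mathcal{P}(E_d)$ of subsets of $E_d$ consider the transition kernel $q(A,\cdot)=\frac12(\delta_{f_+(A)}+\delta_{f_-(A)})$ (direct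 images). $\mathcal{C}$ is the set of recurrent states of this chain having exactly $M$ elements (it is a recurrent class). The map $F:\{-1,1\}^{-\mathbf{N}}\to\mathcal{C}$ is the measurable map (it exists and is unique up to null sets for the uniform product law) such that, for every Markov chain $(X_n)_{n\in\mathbf{Z}}$ on $\mathcal{C}$ with kernel $q$ governed by a coin-tossing sequence $(\eta_n)_{n\in\mathbf{Z}}$, i.e. $X_n=f_{\eta_n}(X_{n-1})$ for all $n$, one has almost surely $X_n=F(\eta_{n]})$ for all $n\in\mathbf{Z}$. *)

theory Defs
  imports "HOL-Probability.Probability"
begin

definition coin_tossing :: "'w measure \<Rightarrow> (int \<Rightarrow> 'w \<Rightarrow> int) \<Rightarrow> bool" where
  "coin_tossing P \<eta> \<longleftrightarrow> prob_space P \<and>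
     prob_space.indep_vars P (\<lambda>_. count_space {-1, 1}) \<eta> UNIV \<and>
     (\<forall>n. distr P (count_space {-1, 1}) (\<eta> n) = uniform_count_measure {-1, 1})"

definition past :: "int \<Rightarrow> (int \<Rightarrow> int) \<Rightarrow> int \<Rightarrow> int" where
  "past n x = (\<lambda>k\<in>{..0}. x (n + k))"

definition cube :: "nat \<Rightarrow> int list set" where
  "cube d = {x. length x = d \<and> set x \<subseteq> {-1, 1}}"

definition step :: "(int list \<Rightarrow> int) \<Rightarrow> int \<Rightarrow> int list \<Rightarrow> int list" where
  "step \<phi> \<alpha> x = tl x @ [\<alpha> * \<phi> x]"

text \<open>In \<open>fold (step \<phi>) \<alpha>s\<close> the head of \<open>\<alpha>s\<close> is applied first.\<close>

definition accordable :: "(int list \<Rightarrow> int) \<Rightarrow> int list \<Rightarrow> int list \<Rightarrow> bool" where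
  "accordable \<phi> a b \<longleftrightarrow>
     (\<exists>\<alpha>s. set \<alpha>s \<subseteq> {-1, 1} \<and> fold (step \<phi>) \<alpha>s a = fold (step \<phi>) \<alpha>s b)"

definition max_nonaccordable :: "nat \<Rightarrow> (int list \<Rightarrow> int) \<Rightarrow> nat" where
  "max_nonaccordable d \<phi> =
     Max (card ` {A. A \<subseteq> cube d \<and> pairwise (\<lambda>a b. \<not> accordable \<phi> a b) A})"

definition set_kernel :: "(int list \<Rightarrow> int) \<Rightarrow> int list set \<Rightarrow> int list set pmf" where
  "set_kernel \<phi> A = map_pmf (\<lambda>\<alpha>. step \<phi> \<alpha> ` A) (pmf_of_set {-1, 1})"

text \<open>Law of \<open>(X\<^sub>1, \<dots>, X\<^sub>n)\<close> for the chain with kernel \<open>K\<close> started at \<open>X\<^sub>0 = x\<close>.\<close>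

primrec path_pmf :: "('s \<Rightarrow> 's pmf) \<Rightarrow> nat \<Rightarrow> 's \<Rightarrow> 's list pmf" where
  "path_pmf K 0 x = return_pmf []"
| "path_pmf K (Suc n) x = bind_pmf (K x) (\<lambda>y. map_pmf ((#) y) (path_pmf K n y))"

text \<open>With \<open>T\<close> the first return time to \<open>x\<close>, the sequence below is \<open>P\<^sub>x(T \<le> n)\<close>, whose limit
  is \<open>P\<^sub>x(T < \<infinity>)\<close>.\<close>

definition recurrent :: "('s \<Rightarrow> 's pmf) \<Rightarrow> 's \<Rightarrow> bool" where
  "recurrent K x \<longleftrightarrow>
     (\<lambda>n. measure_pmf.prob (path_pmf K n x) {ys. x \<in> set ys}) \<longlonglongrightarrow> 1"

definition recurrent_class :: "nat \<Rightarrow> (int list \<Rightarrow> int) \<Rightarrow> int list set set" where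
  "recurrent_class d \<phi> =
     {A. A \<subseteq> cube d \<and> recurrent (set_kernel \<phi>) A \<and> card A = max_nonaccordable d \<phi>}"

definition markov_chain_on ::
  "'w measure \<Rightarrow> 's set \<Rightarrow> ('s \<Rightarrow> 's pmf) \<Rightarrow> (int \<Rightarrow> 'w \<Rightarrow> 's) \<Rightarrow> bool" where
  "markov_chain_on P S K X \<longleftrightarrow> prob_space P \<and> countable S \<and>
     (\<forall>n. X n \<in> measurable P (count_space S)) \<and>
     (\<forall>m n x. m \<le> n \<longrightarrow>
        measure P {\<omega>\<in>space P. \<forall>k\<in>{m..n + 1}. X k \<omega> = x k} =
        measure P {\<omega>\<in>space P. \<forall>k\<in>{m..n}. X k \<omega> = x k} * pmf (K (x n)) (x (n + 1)))"

definition governed_chain ::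
  "'w measure \<Rightarrow> nat \<Rightarrow> (int list \<Rightarrow> int) \<Rightarrow> (int \<Rightarrow> 'w \<Rightarrow> int) \<Rightarrow> (int \<Rightarrow> 'w \<Rightarrow> int list set) \<Rightarrow> bool"
where
  "governed_chain P d \<phi> \<eta> X \<longleftrightarrow> coin_tossing P \<eta> \<and>
     markov_chain_on P (recurrent_class d \<phi>) (set_kernel \<phi>) X \<and>
     (\<forall>n. AE \<omega> in P. X n \<omega> = step \<phi> (\<eta> n \<omega>) ` X (n - 1) \<omega>)"

text \<open>A definition cannot quantify over all sample space types. The type chosen here carries the
  joint law of every pair \<open>(\<eta>, X)\<close>, so nothing is lost: see \<open>past_map_governed_chain\<close> below.\<close>

definition past_map :: "nat \<Rightarrow> (int list \<Rightarrow> int) \<Rightarrow> ((int \<Rightarrow> int) \<Rightarrow> int list set) \<Rightarrow> bool" where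
  "past_map d \<phi> F \<longleftrightarrow>
     F \<in> measurable (Pi\<^sub>M {..0} (\<lambda>_. count_space {-1, 1})) (count_space (recurrent_class d \<phi>)) \<and>
     (\<forall>(P :: (int \<Rightarrow> int \<times> int list set) measure) \<eta> X. governed_chain P d \<phi> \<eta> X \<longrightarrow>
        (AE \<omega> in P. \<forall>n. X n \<omega> = F (past n (\<lambda>k. \<eta> k \<omega>))))"

lemma countable_recurrent_class: "countable (recurrent_class d \<phi>)"
proof -
  have "finite {x::int list. set x \<subseteq> {-1, 1} \<and> length x = d}"
    by (rule finite_lists_length_eq) auto
  then have "finite (cube d)" by (simp add: cube_def conj_commute)
  then have "finite (recurrent_class d \<phi>)"
    by (rule finite_subset[rotated, OF finite_Pow_iff[THEN iffD2]]) (auto simp: recurrent_class_def)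
  then show ?thesis by (rule countable_finite)
qed

lemma past_map_governed_chain:
  fixes P :: "'w measure"
  assumes F: "past_map d \<phi> F" and gov: "governed_chain P d \<phi> \<eta> X"
  shows "AE \<omega> in P. \<forall>n. X n \<omega> = F (past n (\<lambda>k. \<eta> k \<omega>))"
proof -
  let ?S = "count_space {-1, 1::int}" and ?C = "count_space (recurrent_class d \<phi>)"
  define N where "N = Pi\<^sub>M (UNIV :: int set) (\<lambda>_. ?S \<Otimes>\<^sub>M ?C)"
  define T where "T = (\<lambda>\<omega> k. (\<eta> k \<omega>, X k \<omega>))"
  define Q where "Q = distr P N T"
  define h where "h = (\<lambda>k (w :: int \<Rightarrow> int \<times> int list set). fst (w k))"
  define Y where "Y = (\<lambda>k (w :: int \<Rightarrow> int \<times> int list set). snd (w k))"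
  have ct: "coin_tossing P \<eta>" and mc: "markov_chain_on P (recurrent_class d \<phi>) (set_kernel \<phi>) X"
    and rec: "\<And>n. AE \<omega> in P. X n \<omega> = step \<phi> (\<eta> n \<omega>) ` X (n - 1) \<omega>"
    using gov by (auto simp: governed_chain_def)
  interpret P: prob_space P using ct by (simp add: coin_tossing_def)
  have iv: "P.indep_vars (\<lambda>_. ?S) \<eta> UNIV" using ct by (simp add: coin_tossing_def)
  have me [measurable]: "\<eta> k \<in> measurable P ?S" for k
    using iv by (auto simp: P.indep_vars_def)
  have mX [measurable]: "X k \<in> measurable P ?C" for k
    using mc by (auto simp: markov_chain_on_def)
  have T: "T \<in> measurable P N"
    unfolding T_def N_def by (rule measurable_abs_UNIV) measurable
  interpret Q: prob_space Q unfolding Q_def by (rule P.prob_space_distr[OF T])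
  have sQ: "sets Q = sets N" "space Q = space N" by (auto simp: Q_def)
  have mh [measurable]: "h k \<in> measurable N ?S" for k
    unfolding h_def N_def by measurable
  have mY [measurable]: "Y k \<in> measurable N ?C" for k
    unfolding Y_def N_def by measurable
  have hT: "h k (T \<omega>) = \<eta> k \<omega>" and YT: "Y k (T \<omega>) = X k \<omega>" for k \<omega>
    by (auto simp: h_def Y_def T_def)
  have dh: "distr Q ?S (h k) = distr P ?S (\<eta> k)" for k
    unfolding Q_def using distr_distr[OF mh T, of k] by (simp add: comp_def hT)
  have mh': "h k \<in> measurable Q ?S" for k
    using mh measurable_cong_sets[OF sQ(1) refl] by blast
  have all_h: "(\<lambda>w. \<lambda>i\<in>UNIV. h i w) \<in> measurable N (Pi\<^sub>M UNIV (\<lambda>_. ?S))"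
    by measurable
  have "Q.indep_vars (\<lambda>_. ?S) h UNIV"
  proof (subst Q.indep_vars_iff_distr_eq_PiM)
    show "distr Q (Pi\<^sub>M UNIV (\<lambda>_. ?S)) (\<lambda>w. \<lambda>i\<in>UNIV. h i w) = Pi\<^sub>M UNIV (\<lambda>i. distr Q ?S (h i))"
      using P.indep_vars_iff_distr_eq_PiM[THEN iffD1, OF _ _ iv]
      unfolding dh unfolding Q_def distr_distr[OF all_h T] by (simp add: comp_def hT)
  qed (auto simp: mh')
  then have "coin_tossing Q h"
    using ct dh Q.prob_space_axioms by (simp add: coin_tossing_def)
  moreover have "markov_chain_on Q (recurrent_class d \<phi>) (set_kernel \<phi>) Y"
  proof -
    have *: "measure Q {w\<in>space Q. \<forall>k\<in>{a..b}. Y k w = x k} =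
        measure P {\<omega>\<in>space P. \<forall>k\<in>{a..b}. X k \<omega> = x k}" for a b :: int and x
    proof -
      have "{w\<in>space N. \<forall>k\<in>{a..b}. Y k w = x k} \<in> sets N"
        by measurable
      then have "measure Q {w\<in>space N. \<forall>k\<in>{a..b}. Y k w = x k} =
          measure P (T -` {w\<in>space N. \<forall>k\<in>{a..b}. Y k w = x k} \<inter> space P)"
        unfolding Q_def by (rule measure_distr[OF T])
      also have "T -` {w\<in>space N. \<forall>k\<in>{a..b}. Y k w = x k} \<inter> space P =
          {\<omega>\<in>space P. \<forall>k\<in>{a..b}. X k \<omega> = x k}"
        using measurable_space[OF T] by (auto simp: YT)
      finally show ?thesis by (simp add: sQ)
    qed
    show ?thesis
      using mc mY measurable_cong_sets[OF sQ(1) refl] Q.prob_space_axioms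
      unfolding markov_chain_on_def * by blast
  qed
  moreover have "AE w in Q. Y n w = step \<phi> (h n w) ` Y (n - 1) w" for n
  proof -
    have mh': "(\<lambda>w. h n w) \<in> measurable N (count_space UNIV)"
      by (rule measurable_compose[OF mh]) simp
    have mY': "(\<lambda>w. Y k w) \<in> measurable N (count_space UNIV)" for k
      by (rule measurable_compose[OF mY]) simp
    have "{w\<in>space N. Y n w = step \<phi> (h n w) ` Y (n - 1) w} =
      (\<Union>(a, A)\<in>{-1, 1} \<times> recurrent_class d \<phi>.
         h n -` {a} \<inter> space N \<inter> (Y (n - 1) -` {A} \<inter> space N) \<inter> (Y n -` {step \<phi> a ` A} \<inter> space N))"
      using measurable_space[OF mh] measurable_space[OF mY] by fastforce
    also have "\<dots> \<in> sets N"
      by (rule sets.countable_UN')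
        (auto intro!: sets.Int measurable_sets[OF mh'] measurable_sets[OF mY']
          countable_SIGMA countable_recurrent_class)
    finally show ?thesis
      unfolding Q_def by (subst AE_distr_iff[OF T]) (use rec in \<open>auto simp: hT YT\<close>)
  qed
  ultimately have "governed_chain Q d \<phi> h Y" by (simp add: governed_chain_def)
  then have "AE w in Q. \<forall>n. Y n w = F (past n (\<lambda>k. h k w))"
    using F by (auto simp: past_map_def)
  from AE_distrD[OF T this[unfolded Q_def]] show ?thesis by (simp add: hT YT)
qed

definition Phi :: "nat \<Rightarrow> (int list \<Rightarrow> int) \<Rightarrow> (int \<Rightarrow> int) \<Rightarrow> int \<Rightarrow> int" where
  "Phi d \<phi> x = (\<lambda>n. \<phi> (map x [n - int d..n - 1]) * x n)"

text \<open>\<open>\<kappa>\<close> is a version of the conditional law of \<open>Y\<close> (with values in \<open>N\<close>) given \<open>Z\<close> (with values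
  in \<open>L\<close>).\<close>

definition cond_law ::
  "'w measure \<Rightarrow> ('w \<Rightarrow> 'y) \<Rightarrow> 'y measure \<Rightarrow> ('w \<Rightarrow> 'z) \<Rightarrow> 'z measure \<Rightarrow> ('w \<Rightarrow> 'y measure) \<Rightarrow> bool"
where
  "cond_law P Y N Z L \<kappa> \<longleftrightarrow>
     Y \<in> measurable P N \<and> Z \<in> measurable P L \<and>
     \<kappa> \<in> measurable (vimage_algebra (space P) Z L) (prob_algebra N) \<and>
     (\<forall>B\<in>sets N. AE \<omega> in P.
        real_cond_exp P (vimage_algebra (space P) Z L) (indicator (Y -` B \<inter> space P)) \<omega> =
        measure (\<kappa> \<omega>) B)"

end

theory Submission
  imports Defs "HOL-Library.Sublist"
begin

text \<open>Write \<open>\<eta> = Phi d \<phi> \<epsilon>\<close> for the output and call the block of the \<open>d\<close> values of \<open>\<epsilon>\<close> before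
time \<open>i\<close> the state at time \<open>i\<close>. Since \<open>\<phi>\<close> takes the values \<open>-1\<close> and \<open>1\<close>, the next state is
\<open>step \<phi> \<alpha>\<close> of the present one, where \<open>\<alpha>\<close> is the next output; so the state at time \<open>i\<close> is
\<open>run s\<close> of the state at time \<open>i - l\<close>, where \<open>s\<close> is the word of the \<open>l\<close> outputs in between.
The state at time \<open>i - l\<close> is uniform on the cube and independent of all outputs from
\<open>i - l\<close> on, because states and outputs together determine the coins and conversely
(\<open>prob_state_out_word\<close>). Given only the outputs from \<open>i - l\<close> on, the state at time \<open>i\<close>
therefore has as law the image under \<open>run s\<close> of the uniform law on the cube.

The heart of the matter is that this image is exactly uniform as soon as \<open>run s ` cube d\<close> is as
small as it can be (\<open>card_fibre_collapsing\<close>). Call such a word \<open>s\<close> collapsing; the minimal number of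
values is the maximal number of pairwise non-accordable states. Every state is hit by exactly two
pairs (sign, state), so putting a letter in front of \<open>s\<close> replaces the fibre over a point by two
fibres of the same average size. A fibre that is largest among the fibres of all collapsing words
hence keeps its size under every prefix. Since every state leads to every other one, suitable
prefixes move any other fibre of the same word to that place, so all fibres of that
word have this largest size, which must then be \<open>2 ^ d / rank\<close>. For an arbitrary
collapsing word there are \<open>rank\<close> fibres of at most this size, with total size \<open>2 ^ d\<close>; they are all
equal.

It remains to let \<open>l\<close> grow. A long random word is collapsing with probability close to \<open>1\<close>,
because it contains a fixed collapsing word. Once the last \<open>l\<close> outputs form a collapsing word
\<open>s\<close>, looking further back does not change the image \<open>run s ` cube d\<close>: it is the set of states that are
compatible with the whole past of the output (\<open>compatible_eq_image\<close>). These sets form a chain on the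
recurrent class that is governed by \<open>\<eta>\<close> (\<open>governed_chain_chain\<close>), so they are the values of \<open>F\<close>. On an event that
depends on finitely many outputs, the integrals of the indicator of a set of states and of its
uniform probability on the compatible set agree up to the probability that the last \<open>l\<close> outputs are
not collapsing (\<open>abs_integral_gap_le\<close>), hence exactly. Such events generate the output
\<open>\<sigma>\<close>-algebra.\<close>

section \<open>Words and the cube\<close>

definition word :: "(int \<Rightarrow> int) \<Rightarrow> int \<Rightarrow> nat \<Rightarrow> int list" where
  "word x i l = map (\<lambda>j. x (i + int j)) [0..<l]"

lemma length_word [simp]: "length (word x i l) = l"
  by (simp add: word_def)

lemma nth_word: "j < l \<Longrightarrow> word x i l ! j = x (i + int j)"
  by (simp add: word_def)

lemma word_add: "word x i (k + l) = word x i k @ word x (i + int k) l"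
  by (auto simp: word_def intro!: nth_equalityI simp: nth_append)

lemma word_subword:
  assumes "a \<le> b" "b + int m \<le> a + int n"
  shows "word x b m = take m (drop (nat (b - a)) (word x a n))"
proof (rule nth_equalityI)
  show "length (word x b m) = length (take m (drop (nat (b - a)) (word x a n)))"
    using assms by simp
  fix j assume "j < length (word x b m)"
  then have "j < m" by simp
  moreover have "nat (b - a) + j < n" "a + int (nat (b - a) + j) = b + int j"
    using assms \<open>j < m\<close> by auto
  ultimately show "word x b m ! j = take m (drop (nat (b - a)) (word x a n)) ! j"
    using assms by (simp add: nth_word del: of_nat_add)
qed

lemma word_Suc_left: "word x i (Suc l) = x i # word x (i + 1) l"
  using word_add[of x i 1 l] by (simp add: word_def)

lemma word_cong: "(\<And>j. i \<le> j \<Longrightarrow> j < i + int l \<Longrightarrow> x j = y j) \<Longrightarrow> word x i l = word y i l"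
  by (simp add: word_def)

lemma word_Suc: "word x i (Suc l) = word x i l @ [x (i + int l)]"
  by (simp add: word_def)

lemma map_upto_eq_word: "map x [i..j] = word x i (nat (j - i + 1))"
  by (auto simp: word_def intro!: nth_equalityI)

lemma word_in_cube:
  assumes "\<And>j. i \<le> j \<Longrightarrow> j < i + int l \<Longrightarrow> x j \<in> {-1, 1}"
  shows "word x i l \<in> cube l"
proof -
  have "y \<in> {-1, 1}" if y: "y \<in> set (word x i l)" for y
  proof -
    obtain j where "j < l" "y = x (i + int j)" using y by (auto simp: word_def)
    then show ?thesis using assms[of "i + int j"] by simp
  qed
  then show ?thesis by (auto simp: cube_def)
qed

lemma finite_cube: "finite (cube d)"
  using finite_lists_length_eq[of "{-1, 1::int}" d] by (simp add: cube_def conj_commute)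

lemma card_cube: "card (cube d) = 2 ^ d"
proof -
  have "card (cube d) = card {-1, 1::int} ^ d"
    unfolding cube_def conj_commute[of "length _ = _"] by (rule card_lists_length_eq) simp
  also have "card {-1, 1::int} = 2" by simp
  finally show ?thesis .
qed

lemma append_in_cube: "u \<in> cube k \<Longrightarrow> v \<in> cube l \<Longrightarrow> u @ v \<in> cube (k + l)"
  by (auto simp: cube_def)

lemma cube_append_splitE:
  assumes "u \<in> cube (k + l)"
  obtains v w where "u = v @ w" "v \<in> cube k" "w \<in> cube l"
proof
  show "u = take k u @ drop k u" by simp
  show "take k u \<in> cube k" "drop k u \<in> cube l"
    using assms by (auto simp: cube_def dest: in_set_takeD in_set_dropD)
qed

section \<open>Collapsing words\<close>

locale feedback =
  fixes d :: nat and \<phi> :: "int list \<Rightarrow> int"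
  assumes d_pos: "1 \<le> d" and phi: "\<phi> \<in> cube d \<rightarrow> {-1, 1}"
begin

abbreviation run :: "int list \<Rightarrow> int list \<Rightarrow> int list" where
  "run u \<equiv> fold (step \<phi>) u"

abbreviation rank :: nat where "rank \<equiv> max_nonaccordable d \<phi>"

lemma phi_cases: "x \<in> cube d \<Longrightarrow> \<phi> x = -1 \<or> \<phi> x = 1"
  using phi by auto

lemma step_in_cube: "\<alpha> \<in> {-1, 1} \<Longrightarrow> x \<in> cube d \<Longrightarrow> step \<phi> \<alpha> x \<in> cube d"
  using d_pos phi_cases[of x]
  by (cases x) (auto simp: cube_def step_def)

lemma run_in_cube: "set u \<subseteq> {-1, 1} \<Longrightarrow> x \<in> cube d \<Longrightarrow> run u x \<in> cube d"
  by (induction u arbitrary: x) (auto intro: step_in_cube)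

lemma run_append_image: "run (u @ v) ` A = run v ` run u ` A"
  by (simp add: image_image)

text \<open>In \<open>d\<close> steps the original entries are shifted out, and the sign of each new entry can be
chosen freely by compensating the value of \<open>\<phi>\<close>.\<close>

lemma run_transitive:
  assumes a: "a \<in> cube d" and b: "b \<in> cube d"
  shows "\<exists>u. set u \<subseteq> {-1, 1} \<and> run u a = b"
proof -
  have "\<exists>u. set u \<subseteq> {-1, 1} \<and> run u a = drop (length c) a @ c"
    if "length c \<le> d" "set c \<subseteq> {-1, 1}" for c
    using that
  proof (induction c rule: rev_induct)
    case Nil
    show ?case by (intro exI[of _ "[]"]) simp
  next
    case (snoc \<beta> c)
    then obtain u where u: "set u \<subseteq> {-1, 1}" "run u a = drop (length c) a @ c" by auto
    let ?x = "run u a"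
    have x: "?x \<in> cube d" using u a run_in_cube by blast
    then have "\<phi> ?x = -1 \<or> \<phi> ?x = 1" by (rule phi_cases)
    then have "run (u @ [\<beta> * \<phi> ?x]) a = tl ?x @ [\<beta>]" "set (u @ [\<beta> * \<phi> ?x]) \<subseteq> {-1, 1}"
      using u(1) snoc.prems by (auto simp: step_def)
    moreover have "tl ?x = drop (length (c @ [\<beta>])) a @ c"
      using snoc.prems a u(2) by (simp add: cube_def tl_append drop_Suc tl_drop split: list.split)
        (metis add.commute drop_Suc drop_eq_Nil le_antisym list.sel(3) not_less_eq_eq tl_drop)
    ultimately show ?case by (intro exI[of _ "u @ [\<beta> * \<phi> ?x]"]) simp
  qed
  from this[of b] show ?thesis using a b by (auto simp: cube_def)
qed

text \<open>A predecessor of \<open>y\<close> has the form \<open>\<beta> # butlast y\<close> with a free sign \<open>\<beta>\<close>, and then the letter that leads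
to \<open>y\<close> is forced. So every state has two incoming edges: the uniform law is invariant.\<close>

lemma card_step_preimages:
  assumes Q: "Q \<subseteq> cube d"
  shows "card {x \<in> cube d. step \<phi> (-1) x \<in> Q} + card {x \<in> cube d. step \<phi> 1 x \<in> Q} = 2 * card Q"
proof -
  let ?S = "SIGMA \<alpha>:{-1, 1::int}. {x \<in> cube d. step \<phi> \<alpha> x \<in> Q}"
  let ?h = "\<lambda>(\<alpha>, x). (hd x, step \<phi> \<alpha> x)"
  have "inj_on ?h ?S"
  proof (rule inj_onI, clarify)
    fix \<alpha> x \<beta> y assume x: "x \<in> cube d" and y: "y \<in> cube d"
      and hd: "hd x = hd y" and st: "step \<phi> \<alpha> x = step \<phi> \<beta> y"
    have "x \<noteq> []" "y \<noteq> []" using x y d_pos by (auto simp: cube_def)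
    moreover have "tl x = tl y" "\<alpha> * \<phi> x = \<beta> * \<phi> y" using st by (auto simp: step_def)
    ultimately have "x = y" using hd by (simp add: list.expand)
    then show "\<alpha> = \<beta> \<and> x = y" using \<open>\<alpha> * \<phi> x = \<beta> * \<phi> y\<close> phi_cases[OF x] by auto
  qed
  moreover have "?h ` ?S = {-1, 1} \<times> Q"
  proof (intro equalityI subsetI)
    fix p assume "p \<in> ?h ` ?S"
    then obtain \<alpha> x where p: "p = (hd x, step \<phi> \<alpha> x)" "x \<in> cube d" "step \<phi> \<alpha> x \<in> Q" by auto
    have "hd x \<in> set x" using p(2) d_pos by (intro hd_in_set) (auto simp: cube_def)
    then show "p \<in> {-1, 1} \<times> Q" using p by (auto simp: cube_def)
  next
    fix p assume "p \<in> {-1, 1::int} \<times> Q"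
    then obtain \<beta> y where p: "p = (\<beta>, y)" "\<beta> \<in> {-1, 1}" "y \<in> Q" by blast
    have y: "length y = d" "set y \<subseteq> {-1, 1}" using p Q by (auto simp: cube_def)
    then have ne: "y \<noteq> []" using d_pos by auto
    have last: "last y \<in> {-1, 1}" using y last_in_set[OF ne] by blast
    let ?x = "\<beta> # butlast y" and ?\<alpha> = "last y * \<phi> (\<beta> # butlast y)"
    have "set (butlast y) \<subseteq> {-1, 1}" using y(2) in_set_butlastD by fast
    then have x: "?x \<in> cube d" using p(2) y(1) d_pos by (simp add: cube_def)
    have \<alpha>: "?\<alpha> \<in> {-1, 1}" "?\<alpha> * \<phi> ?x = last y" using phi_cases[OF x] last by auto
    have "step \<phi> ?\<alpha> ?x = y" unfolding step_def \<alpha>(2) using ne by simp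
    then have "p = ?h (?\<alpha>, ?x)" "(?\<alpha>, ?x) \<in> ?S" using p x \<alpha>(1) by auto
    then show "p \<in> ?h ` ?S" by (rule image_eqI)
  qed
  ultimately have "bij_betw ?h ?S ({-1, 1} \<times> Q)" by (simp add: bij_betw_def)
  then have "card ?S = card ({-1, 1::int} \<times> Q)" by (rule bij_betw_same_card)
  also have "card ?S = (\<Sum>\<alpha>\<in>{-1, 1}. card {x \<in> cube d. step \<phi> \<alpha> x \<in> Q})"
    by (rule card_SigmaI) (auto simp: finite_cube)
  finally show ?thesis by (simp add: card_cartesian_product)
qed

text \<open>The sets over which \<open>max_nonaccordable\<close> maximises.\<close>

definition separated :: "int list set \<Rightarrow> bool" where
  "separated A \<longleftrightarrow> A \<subseteq> cube d \<and> pairwise (\<lambda>a b. \<not> accordable \<phi> a b) A"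

lemma
  shows card_separated_le_rank: "separated A \<Longrightarrow> card A \<le> rank"
    and ex_separated_card_rank: "\<exists>A. separated A \<and> card A = rank"
proof -
  let ?N = "{A. A \<subseteq> cube d \<and> pairwise (\<lambda>a b. \<not> accordable \<phi> a b) A}"
  have fin: "finite (card ` ?N)"
    by (rule finite_imageI, rule finite_subset[of _ "Pow (cube d)"]) (auto simp: finite_cube)
  show "separated A \<Longrightarrow> card A \<le> rank"
    unfolding max_nonaccordable_def separated_def by (rule Max_ge[OF fin]) auto
  have "{} \<in> ?N" by (simp add: pairwise_def)
  then have "Max (card ` ?N) \<in> card ` ?N" by (intro Max_in[OF fin]) blast
  then show "\<exists>A. separated A \<and> card A = rank"
    unfolding max_nonaccordable_def separated_def by auto
qed

lemma rank_pos: "0 < rank"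
proof -
  obtain a where "a \<in> cube d"
    using card_cube[of d] by (metis card.empty ex_in_conv power_not_zero zero_neq_numeral)
  then have "separated {a}" by (simp add: separated_def pairwise_def)
  then show ?thesis using card_separated_le_rank[of "{a}"] by simp
qed

text \<open>No composite can identify two elements of a separated set, so a separated set of maximal size
survives in every image.\<close>

lemma rank_le_card_image:
  assumes u: "set u \<subseteq> {-1, 1}"
  shows "rank \<le> card (run u ` cube d)"
proof -
  obtain A where A: "separated A" "card A = rank" using ex_separated_card_rank by blast
  have "inj_on (run u) A"
    using A(1) u unfolding separated_def pairwise_def inj_on_def accordable_def by blast
  then have "rank = card (run u ` A)" using A(2) by (simp add: card_image)
  also have "\<dots> \<le> card (run u ` cube d)"
    using A(1) by (intro card_mono image_mono) (auto simp: finite_cube separated_def)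
  finally show ?thesis .
qed

definition collapsing :: "int list \<Rightarrow> bool" where
  "collapsing u \<longleftrightarrow> set u \<subseteq> {-1, 1} \<and> card (run u ` cube d) = rank"

text \<open>In an image of minimal size no pair is accordable, since a word merging the pair would give a
smaller image; so a minimal image is separated and has at most \<open>rank\<close> elements.\<close>

lemma ex_collapsing: "\<exists>u. collapsing u"
proof -
  obtain u where u: "set u \<subseteq> {-1, 1}"
    and least: "\<And>v. set v \<subseteq> {-1, 1} \<Longrightarrow> card (run u ` cube d) \<le> card (run v ` cube d)"
    using ex_has_least_nat[of "\<lambda>u. set u \<subseteq> {-1, 1}" "[]" "\<lambda>u. card (run u ` cube d)"] by auto
  let ?A = "run u ` cube d"
  have "separated ?A"
    unfolding separated_def
  proof (intro conjI pairwiseI notI)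
    show "?A \<subseteq> cube d" using u run_in_cube by blast
    fix a b assume ab: "a \<in> ?A" "b \<in> ?A" "a \<noteq> b" "accordable \<phi> a b"
    then obtain v where v: "set v \<subseteq> {-1, 1}" "run v a = run v b" by (auto simp: accordable_def)
    then have "\<not> inj_on (run v) ?A" using ab by (meson inj_onD)
    then have "card (run v ` ?A) < card ?A"
      using card_image_le[of ?A "run v"] eq_card_imp_inj_on[of ?A "run v"] finite_cube[of d]
      by fastforce
    moreover have "card ?A \<le> card (run (u @ v) ` cube d)" using u v by (intro least) auto
    ultimately show False by (simp only: run_append_image)
  qed
  then have "card ?A = rank"
    using card_separated_le_rank rank_le_card_image[OF u] by (simp add: le_antisym)
  then show ?thesis using u by (auto simp: collapsing_def)
qed

text \<open>A longer past only shrinks the image, and an image of minimal size cannot shrink. This is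
what makes the set of states compatible with the past depend on finitely many outputs.\<close>

lemma collapsing_prepend:
  assumes u: "collapsing u" and v: "set v \<subseteq> {-1, 1}"
  shows "collapsing (v @ u)" and "run (v @ u) ` cube d = run u ` cube d"
proof -
  have sub: "run (v @ u) ` cube d \<subseteq> run u ` cube d"
    unfolding run_append_image using v run_in_cube by (intro image_mono) blast
  have "card (run u ` cube d) \<le> card (run (v @ u) ` cube d)"
    using rank_le_card_image[of "v @ u"] u v by (auto simp: collapsing_def)
  then show eq: "run (v @ u) ` cube d = run u ` cube d"
    using sub by (intro card_seteq) (auto simp: finite_cube)
  then show "collapsing (v @ u)" using u v unfolding collapsing_def by (metis Un_subset_iff set_append)
qed

lemma collapsing_append:
  assumes u: "collapsing u" and v: "set v \<subseteq> {-1, 1}"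
  shows "collapsing (u @ v)"
proof -
  have "card (run (u @ v) ` cube d) \<le> rank"
    unfolding run_append_image using u card_image_le[of "run u ` cube d" "run v"]
    by (simp add: collapsing_def finite_cube)
  then show ?thesis using rank_le_card_image[of "u @ v"] u v by (auto simp: collapsing_def)
qed

definition fibre :: "int list \<Rightarrow> int list \<Rightarrow> int list set" where
  "fibre u y = {x \<in> cube d. run u x = y}"

lemma fibre_subset: "fibre u y \<subseteq> cube d"
  by (auto simp: fibre_def)

lemma card_fibre_step:
  "card (fibre (-1 # u) y) + card (fibre (1 # u) y) = 2 * card (fibre u y)"
proof -
  have "fibre (\<alpha> # u) y = {x \<in> cube d. step \<phi> \<alpha> x \<in> fibre u y}" if "\<alpha> \<in> {-1, 1}" for \<alpha>
    using that step_in_cube by (auto simp: fibre_def)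
  then show ?thesis using card_step_preimages[OF fibre_subset, of u y] by simp
qed

text \<open>A collapsing word maps the uniform law on the cube to the uniform law on its image. The proof
starts from a fibre whose size is maximal over all collapsing words and all points of their images.\<close>

theorem card_fibre_collapsing:
  assumes u: "collapsing u" and y: "y \<in> run u ` cube d"
  shows "card (fibre u y) * rank = 2 ^ d"
proof -
  define Q where "Q p \<longleftrightarrow> collapsing (fst p) \<and> snd p \<in> run (fst p) ` cube d" for p
  have bd: "card (fibre v z) \<le> card (cube d)" for v z
    by (intro card_mono fibre_subset finite_cube)
  have "Q (u, y)" using u y by (simp add: Q_def)
  moreover have "\<forall>q. Q q \<longrightarrow> card (fibre (fst q) (snd q)) < Suc (card (cube d))"
    using bd by (simp add: less_Suc_eq_le)
  ultimately obtain p where p: "Q p"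
    and max: "\<And>q. Q q \<Longrightarrow> card (fibre (fst q) (snd q)) \<le> card (fibre (fst p) (snd p))"
    using ex_has_greatest_nat[of Q "(u, y)" "\<lambda>q. card (fibre (fst q) (snd q))" "Suc (card (cube d))"]
    by blast
  obtain w b where "p = (w, b)" by fastforce
  with p have w: "collapsing w" and b: "b \<in> run w ` cube d" by (auto simp: Q_def)
  define K where "K = card (fibre w b)"
  have le: "card (fibre v z) \<le> K" if "collapsing v" "z \<in> run v ` cube d" for v z
    using max[of "(v, z)"] that \<open>p = (w, b)\<close> by (simp add: Q_def K_def)
  have w': "set w \<subseteq> {-1, 1}" using w by (simp add: collapsing_def)
  \<comment> \<open>The two fibres over \<open>b\<close> obtained by one more letter have average size \<open>K\<close> and are at
    most \<open>K\<close>, so neither is smaller.\<close>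
  have const: "card (fibre (v @ w) b) = K" if "set v \<subseteq> {-1, 1}" for v
    using that
  proof (induction v)
    case Nil
    then show ?case by (simp add: K_def)
  next
    case (Cons \<alpha> v)
    have "card (fibre ((\<beta> # v) @ w) b) \<le> K" if "\<beta> \<in> {-1, 1}" for \<beta>
      using that Cons.prems collapsing_prepend[OF w, of "\<beta> # v"] b by (intro le) auto
    from this[of 1] this[of "-1"] card_fibre_step[of "v @ w" b] Cons show ?case by auto
  qed
  have all: "card (fibre w z) = K" if z: "z \<in> run w ` cube d" for z
  proof -
    \<comment> \<open>A word \<open>t\<close> from \<open>z\<close> to the fibre of \<open>b\<close> makes \<open>t @ w\<close> a permutation of the image that
      sends \<open>z\<close> to \<open>b\<close>; then the fibre of \<open>w @ t @ w\<close> over \<open>b\<close> is the fibre of \<open>w\<close> over \<open>z\<close>.\<close>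
    obtain x where x: "x \<in> cube d" "run w x = b" using b by auto
    have "z \<in> cube d" using z w' run_in_cube by blast
    then obtain t where t: "set t \<subseteq> {-1, 1}" "run t z = x" using run_transitive x(1) by blast
    have im: "run (t @ w) ` run w ` cube d = run w ` cube d"
      using collapsing_prepend(2)[OF w, of "w @ t"] t w' by (simp add: image_image)
    have "inj_on (run (t @ w)) (run w ` cube d)"
      by (rule eq_card_imp_inj_on) (simp_all only: im finite_imageI finite_cube)
    then have "run (t @ w) (run w a) = b \<longleftrightarrow> run w a = z" if "a \<in> cube d" for a
      using that z x t inj_onD[of "run (t @ w)" _ "run w a" z] by auto
    then have "fibre (w @ t @ w) b = fibre w z" by (auto simp: fibre_def)
    then show ?thesis using const[of "w @ t"] t w' by simp
  qed
  have total: "(\<Sum>z\<in>run v ` cube d. card (fibre v z)) = 2 ^ d" for v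
  proof -
    have "(\<Sum>z\<in>run v ` cube d. card (fibre v z)) = card (\<Union>z\<in>run v ` cube d. fibre v z)"
      by (rule card_UN_disjoint[symmetric])
        (auto simp: finite_cube fibre_def)
    also have "(\<Union>z\<in>run v ` cube d. fibre v z) = cube d" by (auto simp: fibre_def)
    finally show ?thesis by (simp add: card_cube)
  qed
  have K: "rank * K = 2 ^ d" using total[of w] all w by (simp add: collapsing_def)
  \<comment> \<open>The \<open>rank\<close> fibres of \<open>u\<close> have sizes at most \<open>K\<close> and total size \<open>rank * K\<close>.\<close>
  have "card (fibre u y) = K"
  proof (rule ccontr)
    assume "card (fibre u y) \<noteq> K"
    then have "card (fibre u y) < K" using le[OF u y] by simp
    then have "(\<Sum>z\<in>run u ` cube d. card (fibre u z)) < (\<Sum>z\<in>run u ` cube d. K)"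
      using y le[OF u] by (intro sum_strict_mono_ex1) (auto simp: finite_cube)
    then show False using total[of u] u K by (simp add: collapsing_def)
  qed
  then show ?thesis using K by (simp add: mult.commute)
qed

end

section \<open>Recurrence of the images of collapsing words\<close>

text \<open>Cut the word into \<open>k\<close> blocks of length \<open>l\<close>: none of them may equal \<open>w\<close>.\<close>

lemma card_words_avoiding:
  assumes w: "w \<in> cube l"
  shows "card {u \<in> cube (k * l). \<not> sublist w u} \<le> (2 ^ l - 1) ^ k"
proof (induction k)
  case 0
  have "{u \<in> cube 0. \<not> sublist w u} \<subseteq> {[]}" by (auto simp: cube_def)
  then have "card {u \<in> cube 0. \<not> sublist w u} \<le> card {[] :: int list}" by (intro card_mono) auto
  then show ?case by simp
next
  case (Suc k)
  let ?A = "{u \<in> cube (k * l). \<not> sublist w u}"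
  have "{u \<in> cube (l + k * l). \<not> sublist w u} \<subseteq> (\<lambda>(a, b). a @ b) ` ((cube l - {w}) \<times> ?A)"
  proof clarify
    fix u assume u: "u \<in> cube (l + k * l)" and av: "\<not> sublist w u"
    obtain a b where ab: "u = a @ b" "a \<in> cube l" "b \<in> cube (k * l)"
      using u by (rule cube_append_splitE)
    have "a \<noteq> w" "\<not> sublist w b"
      using av ab(1) by (auto simp: sublist_append)
    then show "u \<in> (\<lambda>(a, b). a @ b) ` ((cube l - {w}) \<times> ?A)" using ab by auto
  qed
  then have "card {u \<in> cube (l + k * l). \<not> sublist w u} \<le> card ((cube l - {w}) \<times> ?A)"
    by (intro surj_card_le) (auto simp: finite_cube)
  also have "\<dots> = (2 ^ l - 1) * card ?A"
    using w by (simp add: card_cartesian_product card_Diff_singleton finite_cube card_cube)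
  also have "\<dots> \<le> (2 ^ l - 1) * (2 ^ l - 1) ^ k" by (intro mult_left_mono Suc.IH) simp
  finally show ?case by simp
qed

text \<open>The fraction decreases in the length, and along the multiples of \<open>l\<close> it is dominated by a
geometric sequence.\<close>

lemma fraction_words_avoiding_tendsto_0:
  assumes w: "w \<in> cube l"
  shows "(\<lambda>n. card {u \<in> cube n. \<not> sublist w u} / 2 ^ n) \<longlonglongrightarrow> 0"
proof (cases "l = 0")
  case True
  then show ?thesis using w by (simp add: cube_def)
next
  case False
  define r where "r n = card {u \<in> cube n. \<not> sublist w u} / (2 ^ n :: real)" for n
  have "r (Suc n) \<le> r n" for n
  proof -
    let ?A = "{u \<in> cube n. \<not> sublist w u}"
    have "{u \<in> cube (n + 1). \<not> sublist w u} \<subseteq> (\<lambda>(a, b). a @ b) ` (?A \<times> cube 1)"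
    proof clarify
      fix u assume u: "u \<in> cube (n + 1)" and av: "\<not> sublist w u"
      obtain a b where ab: "u = a @ b" "a \<in> cube n" "b \<in> cube 1"
        using u by (rule cube_append_splitE)
      have "\<not> sublist w a" using av ab(1) by (auto simp: sublist_append)
      then show "u \<in> (\<lambda>(a, b). a @ b) ` (?A \<times> cube 1)" using ab by auto
    qed
    then have "card {u \<in> cube (n + 1). \<not> sublist w u} \<le> card (?A \<times> cube 1)"
      by (intro surj_card_le) (auto simp: finite_cube)
    also have "\<dots> = 2 * card ?A"
      by (simp only: card_cartesian_product card_cube) simp
    finally have "real (card {u \<in> cube (Suc n). \<not> sublist w u}) \<le> 2 * real (card ?A)" by simp
    then show ?thesis unfolding r_def by (simp add: field_simps)
  qed
  then have "decseq r" by (rule decseq_SucI)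
  moreover have "\<forall>n. 0 \<le> r n" by (simp add: r_def)
  ultimately obtain L where L: "r \<longlonglongrightarrow> L" using decseq_convergent by blast
  have "(\<lambda>k. r (k * l)) \<longlonglongrightarrow> L"
    using LIMSEQ_subseq_LIMSEQ[OF L, of "\<lambda>k. k * l"] False by (simp add: strict_mono_def comp_def)
  moreover have "(\<lambda>k. r (k * l)) \<longlonglongrightarrow> 0"
  proof (rule tendsto_sandwich[of "\<lambda>_. 0"])
    have "r (k * l) \<le> (1 - 1 / 2 ^ l) ^ k" for k
    proof -
      have "r (k * l) \<le> real ((2 ^ l - 1) ^ k) / 2 ^ (k * l)"
        unfolding r_def using card_words_avoiding[OF w, of k]
        by (intro divide_right_mono of_nat_mono) auto
      also have "\<dots> = ((2 ^ l - 1) / 2 ^ l) ^ k"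
        by (simp add: power_divide power_mult[symmetric] mult.commute of_nat_diff)
      also have "(2 ^ l - 1) / 2 ^ l = (1 - 1 / 2 ^ l :: real)" by (simp add: diff_divide_distrib)
      finally show ?thesis .
    qed
    then show "\<forall>\<^sub>F k in sequentially. r (k * l) \<le> (1 - 1 / 2 ^ l) ^ k" by simp
    show "(\<lambda>k. (1 - 1 / 2 ^ l :: real) ^ k) \<longlonglongrightarrow> 0" by (rule LIMSEQ_realpow_zero) auto
  qed (auto simp: r_def)
  ultimately have "L = 0" by (rule LIMSEQ_unique)
  then show ?thesis using L unfolding r_def[abs_def] by simp
qed

lemma pmf_of_set_cube_Suc:
  "pmf_of_set (cube (Suc n)) =
     bind_pmf (pmf_of_set {-1, 1}) (\<lambda>\<alpha>. map_pmf ((#) \<alpha>) (pmf_of_set (cube n)))"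
proof -
  have ne: "cube n \<noteq> {}" using card_cube[of n] by force
  have img: "cube (Suc n) = (\<lambda>(a, b). a # b) ` ({-1, 1} \<times> cube n)"
    by (auto simp: cube_def length_Suc_conv image_iff)
  have "pmf_of_set (cube (Suc n)) = map_pmf (\<lambda>(a, b). a # b) (pmf_of_set ({-1, 1} \<times> cube n))"
    unfolding img using ne by (intro map_pmf_of_set_inj[symmetric]) (auto simp: inj_on_def finite_cube)
  also have "pmf_of_set ({-1, 1::int} \<times> cube n) = pair_pmf (pmf_of_set {-1, 1}) (pmf_of_set (cube n))"
  proof (rule pmf_eqI)
    fix p :: "int \<times> int list"
    obtain a b where p: "p = (a, b)" by fastforce
    show "pmf (pmf_of_set ({-1, 1} \<times> cube n)) p =
        pmf (pair_pmf (pmf_of_set {-1, 1}) (pmf_of_set (cube n))) p"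
      using pmf_of_set[OF ne finite_cube, of b] pmf_of_set[of "{-1, 1::int}" a]
        pmf_of_set[of "{-1, 1::int} \<times> cube n" "(a, b)"] ne
      by (simp add: p pmf_pair finite_cube card_cartesian_product indicator_def)
  qed
  finally show ?thesis
    by (simp add: pair_pmf_def map_bind_pmf map_pmf_def bind_assoc_pmf bind_return_pmf)
qed

context feedback
begin

lemma collapsing_sublist: "collapsing w \<Longrightarrow> sublist w u \<Longrightarrow> set u \<subseteq> {-1, 1} \<Longrightarrow> collapsing u"
proof -
  assume w: "collapsing w" and "sublist w u" and u: "set u \<subseteq> {-1, 1}"
  then obtain p s where "u = p @ w @ s" unfolding sublist_def by blast
  then show "collapsing u"
    using collapsing_append[OF collapsing_prepend(1)[OF w, of p], of s] u by simp
qed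

text \<open>The sets visited by the chain on subsets, started at \<open>A\<close>, when the letters of the
word are used one after the other; \<open>A\<close> itself is not listed.\<close>

primrec image_trace :: "int list set \<Rightarrow> int list \<Rightarrow> int list set list" where
  "image_trace A [] = []"
| "image_trace A (\<alpha> # u) = step \<phi> \<alpha> ` A # image_trace (step \<phi> \<alpha> ` A) u"

lemma path_pmf_set_kernel:
  "path_pmf (set_kernel \<phi>) n A = map_pmf (image_trace A) (pmf_of_set (cube n))"
proof (induction n arbitrary: A)
  case 0
  have "cube 0 = {[]}" by (auto simp: cube_def)
  then show ?case by (simp add: pmf_of_set_singleton)
next
  case (Suc n)
  have step: "path_pmf (set_kernel \<phi>) (Suc n) A =
      bind_pmf (set_kernel \<phi> A) (\<lambda>B. map_pmf ((#) B) (map_pmf (image_trace B) (pmf_of_set (cube n))))"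
    by (simp add: Suc)
  show ?case
    unfolding step
    by (simp add: pmf_of_set_cube_Suc set_kernel_def map_bind_pmf bind_map_pmf pmf.map_comp comp_def)
qed

lemma image_run_in_image_trace: "p \<noteq> [] \<Longrightarrow> run p ` A \<in> set (image_trace A (p @ s))"
proof (induction p arbitrary: A)
  case (Cons \<alpha> p)
  show ?case
  proof (cases "p = []")
    case False
    then have "run p ` step \<phi> \<alpha> ` A \<in> set (image_trace (step \<phi> \<alpha> ` A) (p @ s))" by (rule Cons.IH)
    then show ?thesis by (simp add: image_image)
  qed simp
qed simp

text \<open>Whatever letters came before, an occurrence of \<open>u\<close> brings the chain back to \<open>run u ` cube d\<close>. So the
letters of a path that does not return avoid a fixed word.\<close>

lemma image_collapsing_recurrent:
  assumes u: "collapsing u"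
  shows "run u ` cube d \<in> recurrent_class d \<phi>"
proof -
  \<comment> \<open>A nonempty word with the same image: the starting set does not count as a return.\<close>
  define w where "w = 1 # u"
  define A where "A = run w ` cube d"
  have w: "collapsing w" and A_eq: "A = run u ` cube d"
    using collapsing_prepend[OF u, of "[1]"] by (auto simp: w_def A_def)
  have wl: "w \<in> cube (length w)" and sub: "A \<subseteq> cube d"
    using w run_in_cube by (auto simp: A_def cube_def collapsing_def)
  let ?p = "\<lambda>n. measure_pmf.prob (path_pmf (set_kernel \<phi>) n A) {ys. A \<in> set ys}"
  have lower: "1 - card {u \<in> cube n. \<not> sublist w u} / 2 ^ n \<le> ?p n" for n
  proof -
    have hit: "A \<in> set (image_trace A v)" if v: "v \<in> cube n" "sublist w v" for v
    proof -
      obtain p s where vps: "v = p @ w @ s" using v(2) by (auto simp: sublist_def)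
      have "run (p @ w) ` A = run (w @ p @ w) ` cube d" by (simp add: A_def image_image)
      also have "\<dots> = A"
        using collapsing_prepend(2)[OF w, of "w @ p"] v(1) vps by (simp add: A_def cube_def)
      finally show ?thesis
        using image_run_in_image_trace[of "p @ w" A s] vps by (simp add: w_def)
    qed
    have ne: "cube n \<noteq> {}" using card_cube[of n] by force
    have "?p n = measure_pmf.prob (pmf_of_set (cube n)) {v. A \<in> set (image_trace A v)}"
      by (simp add: path_pmf_set_kernel vimage_def)
    also have "\<dots> = 1 - measure_pmf.prob (pmf_of_set (cube n)) {v. A \<notin> set (image_trace A v)}"
      by (subst measure_pmf.prob_compl[symmetric]) (auto intro!: arg_cong[where f = "measure _"])
    also have "measure_pmf.prob (pmf_of_set (cube n)) {v. A \<notin> set (image_trace A v)}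
        = card (cube n \<inter> {v. A \<notin> set (image_trace A v)}) / 2 ^ n"
      using ne by (simp add: measure_pmf_of_set finite_cube card_cube)
    finally have "?p n = 1 - card (cube n \<inter> {v. A \<notin> set (image_trace A v)}) / 2 ^ n" .
    moreover have "card (cube n \<inter> {v. A \<notin> set (image_trace A v)}) \<le> card {u \<in> cube n. \<not> sublist w u}"
      using hit by (intro card_mono) (auto simp: finite_cube)
    ultimately show ?thesis by (simp add: divide_right_mono)
  qed
  have "?p \<longlonglongrightarrow> 1"
  proof (rule tendsto_sandwich)
    show "(\<lambda>n. 1 - card {u \<in> cube n. \<not> sublist w u} / 2 ^ n) \<longlonglongrightarrow> 1"
      using tendsto_diff[OF tendsto_const fraction_words_avoiding_tendsto_0[OF wl], of 1] by simp
  qed (use lower in auto)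
  then show ?thesis
    using u sub by (simp add: recurrent_class_def recurrent_def collapsing_def A_eq)
qed

end

section \<open>Laws on sequences of signs\<close>

abbreviation sign_space :: "int measure" where "sign_space \<equiv> count_space {-1, 1}"

abbreviation sequence_space :: "(int \<Rightarrow> int) measure" where
  "sequence_space \<equiv> Pi\<^sub>M UNIV (\<lambda>_. sign_space)"

lemma measurable_word:
  assumes "\<And>j. i \<le> j \<Longrightarrow> j < i + int l \<Longrightarrow> x j \<in> measurable M sign_space"
  shows "(\<lambda>\<omega>. word (\<lambda>j. x j \<omega>) i l) \<in> measurable M (count_space UNIV)"
  using assms
proof (induction l)
  case 0
  show ?case by (simp add: word_def)
next
  case (Suc l)
  have "x (i + int l) \<in> measurable M sign_space" by (rule Suc.prems) auto
  then have 1: "x (i + int l) \<in> measurable M (count_space UNIV)"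
    by (rule measurable_compose) simp
  have 2: "(\<lambda>\<omega>. word (\<lambda>j. x j \<omega>) i l) \<in> measurable M (count_space UNIV)"
    by (rule Suc.IH) (rule Suc.prems, auto)
  have "(\<lambda>\<omega>. word (\<lambda>j. x j \<omega>) i l @ [x (i + int l) \<omega>]) \<in> measurable M (count_space UNIV)"
    by (rule measurable_compose_countable[where g = "\<lambda>\<omega>. word (\<lambda>j. x j \<omega>) i l", OF _ 2],
        rule measurable_compose[OF 1]) simp
  then show ?case by (simp add: word_Suc)
qed

text \<open>Cylinders over windows centred at \<open>0\<close> are nested or disjoint, hence closed under intersection
up to the empty set.\<close>

definition cylinder :: "nat \<Rightarrow> int list \<Rightarrow> (int \<Rightarrow> int) set" where
  "cylinder k v = {x \<in> space sequence_space. word x (- int k) (2 * k) = v}"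

lemma cylinder_in_sets: "cylinder k v \<in> sets sequence_space"
proof -
  have "(\<lambda>x. word (\<lambda>j. x j) (- int k) (2 * k)) \<in> measurable sequence_space (count_space UNIV)"
    by (rule measurable_word) measurable
  from measurable_sets[OF this, of "{v}"] show ?thesis
    by (simp add: cylinder_def vimage_def Int_def conj_commute)
qed

lemma cylinder_Int:
  assumes "k \<le> m"
  shows "cylinder k u \<inter> cylinder m v = (if take (2 * k) (drop (m - k) v) = u then cylinder m v else {})"
  using assms word_subword[of "- int m" "- int k" "2 * k" "2 * m"]
  by (auto simp: cylinder_def nat_diff_distrib)

lemma Int_stable_cylinders: "Int_stable (insert {} (range (case_prod cylinder)))"
proof (rule Int_stableI)
  fix A B assume "A \<in> insert {} (range (case_prod cylinder))" "B \<in> insert {} (range (case_prod cylinder))"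
  then have "(A = {} \<or> B = {}) \<or> (\<exists>k u m v. A = cylinder k u \<and> B = cylinder m v)" by auto
  moreover have "cylinder k u \<inter> cylinder m v \<in> insert {} (range (case_prod cylinder))" for k u m v
  proof (cases "k \<le> m")
    case True
    show ?thesis unfolding cylinder_Int[OF True] by auto
  next
    case False
    then have "m \<le> k" by simp
    show ?thesis unfolding Int_commute[of "cylinder k u"] cylinder_Int[OF \<open>m \<le> k\<close>] by auto
  qed
  ultimately show "A \<inter> B \<in> insert {} (range (case_prod cylinder))" by blast
qed

lemma sets_sequence_space:
  "sets sequence_space = sigma_sets (space sequence_space) (insert {} (range (case_prod cylinder)))"
proof
  let ?E = "insert {} (range (case_prod cylinder))"
  have sub: "?E \<subseteq> Pow (space sequence_space)" by (auto simp: cylinder_def)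
  define N where "N = sigma (space sequence_space) ?E"
  have N: "space N = space sequence_space" "sets N = sigma_sets (space sequence_space) ?E"
    unfolding N_def using sub by (rule space_measure_of, rule sets_measure_of)
  show "sigma_sets (space sequence_space) ?E \<subseteq> sets sequence_space"
    by (rule sets.sigma_sets_subset) (use cylinder_in_sets in auto)
  have "sets sequence_space \<subseteq> sets N"
  proof (rule sets_PiM_in_sets)
    show "space N = (\<Pi>\<^sub>E i\<in>UNIV. space sign_space)" by (simp add: N(1) space_PiM)
    fix i :: int and A :: "int set"
    define k where "k = Suc (nat \<bar>i\<bar>)"
    define j where "j = nat (i + int k)"
    have k: "\<bar>i\<bar> < int k" by (simp add: k_def)
    then have j: "int j = i + int k" unfolding j_def by linarith
    have "j < 2 * k" "- int k + int j = i" using k j by auto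
    then have "word x (- int k) (2 * k) ! j = x i" for x by (simp add: nth_word)
    then have "{x \<in> space N. x i \<in> A} = (\<Union>v\<in>{v. v ! j \<in> A}. cylinder k v)"
      by (auto simp: N(1) cylinder_def)
    also have "\<dots> \<in> sets N"
      by (rule sets.countable_UN') (auto simp: N(2))
    finally show "{x \<in> space N. x i \<in> A} \<in> sets N" .
  qed
  then show "sets sequence_space \<subseteq> sigma_sets (space sequence_space) ?E" by (simp add: N(2))
qed

lemma sequence_measure_eqI:
  assumes M: "finite_measure M" "sets M = sets sequence_space" and N: "sets N = sets sequence_space"
    and eq: "\<And>k v. emeasure M (cylinder k v) = emeasure N (cylinder k v)"
  shows "M = N"
proof (rule measure_eqI_generator_eq[OF Int_stable_cylinders])
  show "insert {} (range (case_prod cylinder)) \<subseteq> Pow (space sequence_space)"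
    by (auto simp: cylinder_def)
  show "sets M = sigma_sets (space sequence_space) (insert {} (range (case_prod cylinder)))"
    "sets N = sigma_sets (space sequence_space) (insert {} (range (case_prod cylinder)))"
    using M(2) N sets_sequence_space by simp_all
  show "emeasure M X = emeasure N X" if "X \<in> insert {} (range (case_prod cylinder))" for X
    using that eq by auto
  have "cylinder 0 [] = space sequence_space" by (auto simp: cylinder_def word_def)
  then show "(\<Union>i::nat. cylinder 0 []) = space sequence_space"
    by simp
  show "range (\<lambda>i::nat. cylinder 0 []) \<subseteq> insert {} (range (case_prod cylinder))" by auto
  show "emeasure M (cylinder 0 []) \<noteq> \<infinity>" using finite_measure.emeasure_finite[OF M(1)] by simp
qed

context
  fixes P :: "'w measure" and \<epsilon> :: "int \<Rightarrow> 'w \<Rightarrow> int"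
  assumes coin: "coin_tossing P \<epsilon>"
begin

interpretation prob_space P using coin by (simp add: coin_tossing_def)

lemma coin_measurable: "\<epsilon> j \<in> measurable P sign_space"
  using coin by (auto simp: coin_tossing_def indep_vars_def)

lemma coin_sign: "\<omega> \<in> space P \<Longrightarrow> \<epsilon> j \<omega> \<in> {-1, 1}"
  using measurable_space[OF coin_measurable] by auto

lemma coin_prob: "\<alpha> \<in> {-1, 1} \<Longrightarrow> prob {\<omega> \<in> space P. \<epsilon> j \<omega> = \<alpha>} = 1 / 2"
proof -
  assume \<alpha>: "\<alpha> \<in> {-1, 1}"
  have "prob {\<omega> \<in> space P. \<epsilon> j \<omega> = \<alpha>} = measure (distr P sign_space (\<epsilon> j)) {\<alpha>}"
    using \<alpha> by (subst measure_distr[OF coin_measurable]) (auto intro!: arg_cong[where f = prob])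
  also have "distr P sign_space (\<epsilon> j) = uniform_count_measure {-1, 1}"
    using coin by (simp add: coin_tossing_def)
  also have "measure (uniform_count_measure {-1, 1}) {\<alpha>} = 1 / 2"
    using \<alpha> by (subst measure_uniform_count_measure) auto
  finally show ?thesis .
qed

lemma coin_prob_word:
  assumes v: "v \<in> cube l"
  shows "prob {\<omega> \<in> space P. word (\<lambda>j. \<epsilon> j \<omega>) i l = v} = 1 / 2 ^ l"
proof (cases "l = 0")
  case True
  then show ?thesis using v prob_space by (simp add: cube_def word_def)
next
  case False
  have len: "length v = l" using v by (simp add: cube_def)
  let ?J = "(\<lambda>j. i + int j) ` {..<l}"
  let ?A = "\<lambda>j. {v ! nat (j - i)}"
  have A: "?A j \<in> sets sign_space" "v ! nat (j - i) \<in> {-1, 1}" if "j \<in> ?J" for j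
  proof -
    have "v ! nat (j - i) \<in> set v" using that len by auto
    then show "?A j \<in> sets sign_space" "v ! nat (j - i) \<in> {-1, 1}" using v by (auto simp: cube_def)
  qed
  have "{\<omega> \<in> space P. word (\<lambda>j. \<epsilon> j \<omega>) i l = v} = (\<Inter>j\<in>?J. \<epsilon> j -` ?A j \<inter> space P)"
    using False len by (auto simp: word_def list_eq_iff_nth_eq)
  also have "prob \<dots> = (\<Prod>j\<in>?J. prob (\<epsilon> j -` ?A j \<inter> space P))"
    using coin False A(1) by (intro indep_varsD[where M' = "\<lambda>_. sign_space" and I = UNIV])
      (auto simp: coin_tossing_def)
  also have "\<dots> = (\<Prod>j\<in>?J. 1 / 2)"
  proof (rule prod.cong[OF refl])
    fix j assume "j \<in> ?J"
    from coin_prob[OF A(2)[OF this], of j] show "prob (\<epsilon> j -` ?A j \<inter> space P) = 1 / 2"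
      by (simp add: vimage_def Int_def conj_commute)
  qed
  also have "\<dots> = 1 / 2 ^ l"
    by (simp add: card_image inj_on_def power_one_over)
  finally show ?thesis .
qed

lemma coin_word_event: "{\<omega> \<in> space P. Q (word (\<lambda>j. \<epsilon> j \<omega>) i l)} \<in> sets P"
  using measurable_sets[OF measurable_word[of i l, OF coin_measurable], of "Collect Q"]
  by (simp add: vimage_def Int_def conj_commute)

lemma coin_prob_word_in:
  "prob {\<omega> \<in> space P. Q (word (\<lambda>j. \<epsilon> j \<omega>) i l)} = card {v \<in> cube l. Q v} / 2 ^ l"
proof -
  have "word (\<lambda>j. \<epsilon> j \<omega>) i l \<in> cube l" if "\<omega> \<in> space P" for \<omega>
    using that coin_sign by (intro word_in_cube) auto
  then have "{\<omega> \<in> space P. Q (word (\<lambda>j. \<epsilon> j \<omega>) i l)} =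
      (\<Union>v\<in>{v \<in> cube l. Q v}. {\<omega> \<in> space P. word (\<lambda>j. \<epsilon> j \<omega>) i l = v})"
    by auto
  also have "prob \<dots> = (\<Sum>v\<in>{v \<in> cube l. Q v}. prob {\<omega> \<in> space P. word (\<lambda>j. \<epsilon> j \<omega>) i l = v})"
    using coin_word_event[of "\<lambda>u. u = v" i l for v]
    by (intro finite_measure_finite_Union) (auto simp: finite_cube disjoint_family_on_def)
  also have "\<dots> = card {v \<in> cube l. Q v} / 2 ^ l"
    by (simp add: coin_prob_word)
  finally show ?thesis .
qed

end

text \<open>The word probabilities determine the law of the whole sequence, which is then that of \<open>\<epsilon>\<close>.\<close>

lemma coin_tossingI_prob_word:
  assumes \<epsilon>: "coin_tossing P \<epsilon>" and meas: "\<And>j. \<eta> j \<in> measurable P sign_space"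
    and words: "\<And>i l v. v \<in> cube l \<Longrightarrow>
      measure P {\<omega> \<in> space P. word (\<lambda>j. \<eta> j \<omega>) i l = v} = 1 / 2 ^ l"
  shows "coin_tossing P \<eta>"
proof -
  interpret prob_space P using \<epsilon> by (simp add: coin_tossing_def)
  have \<epsilon>_seq: "(\<lambda>\<omega> j. \<epsilon> j \<omega>) \<in> measurable P sequence_space"
    and \<eta>_seq: "(\<lambda>\<omega> j. \<eta> j \<omega>) \<in> measurable P sequence_space"
    by (rule measurable_abs_UNIV, rule coin_measurable[OF \<epsilon>])
      (rule measurable_abs_UNIV, rule meas)
  have law: "distr P sequence_space (\<lambda>\<omega> j. \<eta> j \<omega>) = distr P sequence_space (\<lambda>\<omega> j. \<epsilon> j \<omega>)"
  proof (rule sequence_measure_eqI)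
    show "finite_measure (distr P sequence_space (\<lambda>\<omega> j. \<eta> j \<omega>))"
      by (rule finite_measure_distr[OF \<eta>_seq])
    fix k v
    have pre: "emeasure (distr P sequence_space (\<lambda>\<omega> j. y j \<omega>)) (cylinder k v) =
        measure P {\<omega> \<in> space P. word (\<lambda>j. y j \<omega>) (- int k) (2 * k) = v}"
      if "(\<lambda>\<omega> j. y j \<omega>) \<in> measurable P sequence_space" for y
    proof -
      have "(\<lambda>\<omega> j. y j \<omega>) -` cylinder k v \<inter> space P =
          {\<omega> \<in> space P. word (\<lambda>j. y j \<omega>) (- int k) (2 * k) = v}"
        using measurable_space[OF that] by (auto simp: cylinder_def)
      then show ?thesis
        by (simp add: emeasure_distr[OF that cylinder_in_sets] emeasure_eq_measure)
    qed
    have "measure P {\<omega> \<in> space P. word (\<lambda>j. \<eta> j \<omega>) (- int k) (2 * k) = v} =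
        measure P {\<omega> \<in> space P. word (\<lambda>j. \<epsilon> j \<omega>) (- int k) (2 * k) = v}"
    proof (cases "v \<in> cube (2 * k)")
      case True
      then show ?thesis by (simp add: words coin_prob_word[OF \<epsilon>])
    next
      case False
      have "word (\<lambda>j. y j \<omega>) (- int k) (2 * k) \<in> cube (2 * k)"
        if "\<And>j. y j \<in> measurable P sign_space" "\<omega> \<in> space P" for y :: "int \<Rightarrow> 'a \<Rightarrow> int" and \<omega>
        using measurable_space[OF that(1) that(2)] by (intro word_in_cube) simp
      from this[of \<eta>, OF meas] this[of \<epsilon>, OF coin_measurable[OF \<epsilon>]] False
      have "{\<omega> \<in> space P. word (\<lambda>j. \<eta> j \<omega>) (- int k) (2 * k) = v} = {}"
        "{\<omega> \<in> space P. word (\<lambda>j. \<epsilon> j \<omega>) (- int k) (2 * k) = v} = {}" by auto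
      then show ?thesis by (simp only:)
    qed
    then show "emeasure (distr P sequence_space (\<lambda>\<omega> j. \<eta> j \<omega>)) (cylinder k v) =
        emeasure (distr P sequence_space (\<lambda>\<omega> j. \<epsilon> j \<omega>)) (cylinder k v)"
      by (simp add: pre[OF \<eta>_seq] pre[OF \<epsilon>_seq])
  qed simp_all
  have marginal: "distr P sign_space (\<eta> j) = distr P sign_space (\<epsilon> j)" for j
  proof -
    have comp: "(\<lambda>x. x j) \<in> measurable sequence_space sign_space" by measurable
    have "distr P sign_space (\<eta> j) = distr (distr P sequence_space (\<lambda>\<omega> j. \<eta> j \<omega>)) sign_space (\<lambda>x. x j)"
      by (simp add: distr_distr[OF comp \<eta>_seq] comp_def)
    also have "\<dots> = distr P sign_space (\<epsilon> j)"
      unfolding law by (simp add: distr_distr[OF comp \<epsilon>_seq] comp_def)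
    finally show ?thesis .
  qed
  have "indep_vars (\<lambda>_. sign_space) \<epsilon> UNIV"
    using \<epsilon> by (simp add: coin_tossing_def)
  then have "distr P sequence_space (\<lambda>\<omega> j. \<epsilon> j \<omega>) = Pi\<^sub>M UNIV (\<lambda>j. distr P sign_space (\<epsilon> j))"
    by (subst (asm) indep_vars_iff_distr_eq_PiM) (auto simp: coin_measurable[OF \<epsilon>] restrict_UNIV)
  then have "indep_vars (\<lambda>_. sign_space) \<eta> UNIV"
    by (subst indep_vars_iff_distr_eq_PiM) (auto simp: meas law marginal restrict_UNIV)
  then show ?thesis using \<epsilon> marginal by (simp add: coin_tossing_def)
qed

lemma coin_next_independent:
  assumes coin: "coin_tossing P \<eta>" and E: "E \<in> sets (Pi\<^sub>M {..n} (\<lambda>_. sign_space))"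
    and \<alpha>: "\<alpha> \<in> {-1, 1}"
  shows "measure P {\<omega> \<in> space P. (\<lambda>j\<in>{..n}. \<eta> j \<omega>) \<in> E \<and> \<eta> (n + 1) \<omega> = \<alpha>} =
    measure P {\<omega> \<in> space P. (\<lambda>j\<in>{..n}. \<eta> j \<omega>) \<in> E} / 2"
proof -
  interpret prob_space P using coin by (simp add: coin_tossing_def)
  let ?L = "Pi\<^sub>M {..n} (\<lambda>_. sign_space)" and ?R = "Pi\<^sub>M {n + 1} (\<lambda>_. sign_space)"
  let ?l = "\<lambda>\<omega>. \<lambda>j\<in>{..n}. \<eta> j \<omega>" and ?r = "\<lambda>\<omega>. \<lambda>j\<in>{n + 1}. \<eta> j \<omega>"
  let ?N = "{y \<in> space ?R. y (n + 1) = \<alpha>}"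
  have "indep_var ?L ?l ?R ?r"
    using coin by (intro indep_var_restrict[where I = UNIV]) (auto simp: coin_tossing_def)
  moreover have "?N \<in> sets ?R"
  proof -
    have "(\<lambda>y. y (n + 1)) \<in> measurable ?R sign_space" by measurable
    from measurable_sets[OF this, of "{\<alpha>}"] \<alpha> show ?thesis
      by (simp add: vimage_def Int_def conj_commute)
  qed
  ultimately have *: "prob ((\<lambda>\<omega>. (?l \<omega>, ?r \<omega>)) -` (E \<times> ?N) \<inter> space P) =
      prob (?l -` E \<inter> space P) * prob (?r -` ?N \<inter> space P)"
    using E by (intro indep_varD)
  have r: "?r \<omega> \<in> ?N \<longleftrightarrow> \<eta> (n + 1) \<omega> = \<alpha>" if "\<omega> \<in> space P" for \<omega>
    using coin_sign[OF coin that, of "n + 1"] by (auto simp: space_PiM)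
  have 1: "(\<lambda>\<omega>. (?l \<omega>, ?r \<omega>)) -` (E \<times> ?N) \<inter> space P =
      {\<omega> \<in> space P. ?l \<omega> \<in> E \<and> \<eta> (n + 1) \<omega> = \<alpha>}"
    using r by blast
  have 2: "?r -` ?N \<inter> space P = {\<omega> \<in> space P. \<eta> (n + 1) \<omega> = \<alpha>}" using r by blast
  have 3: "?l -` E \<inter> space P = {\<omega> \<in> space P. ?l \<omega> \<in> E}" by blast
  show ?thesis using * unfolding 1 2 3 coin_prob[OF coin \<alpha>] by simp
qed

section \<open>The state driven by the output sequence\<close>

context feedback
begin

definition state :: "(int \<Rightarrow> int) \<Rightarrow> int \<Rightarrow> int list" where
  "state x i = word x (i - int d) d"

lemma state_in_cube: "(\<And>j. x j \<in> {-1, 1}) \<Longrightarrow> state x i \<in> cube d"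
  unfolding state_def by (rule word_in_cube)

lemma Phi_eq: "Phi d \<phi> x i = \<phi> (state x i) * x i"
  by (simp add: Phi_def state_def map_upto_eq_word)

lemma Phi_sign: "(\<And>j. x j \<in> {-1, 1}) \<Longrightarrow> Phi d \<phi> x i \<in> {-1, 1}"
proof -
  assume x: "\<And>j. x j \<in> {-1, 1}"
  show ?thesis using phi_cases[OF state_in_cube[of x i, OF x]] x[of i] by (auto simp: Phi_eq)
qed

lemma state_step:
  assumes x: "\<And>j. x j \<in> {-1, 1}"
  shows "state x (i + 1) = step \<phi> (Phi d \<phi> x i) (state x i)"
proof -
  have "x (i - int d) # state x (i + 1) = state x i @ [x i]"
    using word_Suc_left[of x "i - int d" d] word_Suc[of x "i - int d" d]
    by (simp add: state_def algebra_simps)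
  then have "tl (state x i @ [x i]) = state x (i + 1)" by (metis list.sel(3))
  moreover have "state x i \<noteq> []" using d_pos by (auto simp: state_def dest: arg_cong[where f = length])
  moreover have "Phi d \<phi> x i * \<phi> (state x i) = x i"
    using phi_cases[OF state_in_cube[of x i, OF x]] by (auto simp: Phi_eq)
  ultimately show ?thesis by (simp add: step_def)
qed

lemma state_run:
  assumes "\<And>j. x j \<in> {-1, 1}"
  shows "state x (i + int l) = run (word (Phi d \<phi> x) i l) (state x i)"
proof (induction l)
  case (Suc l)
  have "state x (i + int (Suc l)) = state x ((i + int l) + 1)" by (simp add: algebra_simps)
  then show ?case using state_step[of x "i + int l", OF assms] Suc by (simp add: word_Suc)
qed (simp add: word_def)

text \<open>A state together with the outputs that follow it encodes the same information as the coins
of the whole window. So the state is uniform and independent of the later outputs.\<close>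

lemma state_Phi_word_determined:
  assumes a: "a \<in> cube d" and "u \<in> cube l"
  shows "\<exists>v\<in>cube (d + l). \<forall>x. (\<forall>j. x j \<in> {-1, 1}) \<longrightarrow>
    (state x i = a \<and> word (Phi d \<phi> x) i l = u \<longleftrightarrow> word x (i - int d) (d + l) = v)"
  using assms(2)
proof (induction l arbitrary: u)
  case 0
  then show ?case using a by (intro bexI[of _ a]) (auto simp: state_def cube_def word_def)
next
  case (Suc l)
  then have "u \<in> cube (l + 1)" by simp
  then obtain u' u'' where u: "u = u' @ u''" "u' \<in> cube l" "u'' \<in> cube 1"
    by (rule cube_append_splitE)
  then obtain \<alpha> where \<alpha>: "u'' = [\<alpha>]" "\<alpha> \<in> {-1, 1}"
    by (auto simp: cube_def length_Suc_conv)
  obtain v where v: "v \<in> cube (d + l)"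
    "\<And>x. (\<forall>j. x j \<in> {-1, 1}) \<Longrightarrow>
      (state x i = a \<and> word (Phi d \<phi> x) i l = u' \<longleftrightarrow> word x (i - int d) (d + l) = v)"
    using Suc.IH[OF u(2)] by blast
  let ?b = "run u' a"
  have b: "?b \<in> cube d" using u(2) a run_in_cube by (auto simp: cube_def)
  have "state x i = a \<and> word (Phi d \<phi> x) i (Suc l) = u \<longleftrightarrow>
      word x (i - int d) (d + Suc l) = v @ [\<phi> ?b * \<alpha>]" if x: "\<forall>j. x j \<in> {-1, 1}" for x
  proof -
    have "Phi d \<phi> x (i + int l) = \<alpha> \<longleftrightarrow> x (i + int l) = \<phi> ?b * \<alpha>"
      if "state x i = a" "word (Phi d \<phi> x) i l = u'"
    proof -
      have "state x (i + int l) = ?b" using state_run[of x i l] x that by simp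
      then show ?thesis using phi_cases[OF b] by (auto simp: Phi_eq)
    qed
    moreover have "word x (i - int d) (d + Suc l) = word x (i - int d) (d + l) @ [x (i + int l)]"
      by (simp add: word_Suc)
    ultimately show ?thesis using v(2)[OF x] by (auto simp: word_Suc u(1) \<alpha>(1))
  qed
  moreover have "v @ [\<phi> ?b * \<alpha>] \<in> cube (d + Suc l)"
    using v(1) \<alpha>(2) phi_cases[OF b] by (auto simp: cube_def)
  ultimately show ?case by blast
qed

section \<open>States compatible with the past\<close>

definition compatible :: "(int \<Rightarrow> int) \<Rightarrow> int \<Rightarrow> int list set" where
  "compatible y i = (\<Inter>k. run (word y (i - int k) k) ` cube d)"

lemma compatible_cong: "(\<And>j. j < i \<Longrightarrow> x j = y j) \<Longrightarrow> compatible x i = compatible y i"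
proof -
  assume "\<And>j. j < i \<Longrightarrow> x j = y j"
  then have "word x (i - int k) k = word y (i - int k) k" for k by (intro word_cong) simp
  then show ?thesis by (simp add: compatible_def)
qed

lemma compatible_subset: "compatible y i \<subseteq> cube d"
  unfolding compatible_def using INT_lower[of 0 UNIV "\<lambda>k. run (word y (i - int k) k) ` cube d"] by (simp add: word_def)

text \<open>The intersection runs over a decreasing sequence of sets, which is constant from the first
collapsing word on.\<close>

lemma compatible_eq_image:
  assumes y: "\<And>j. j < i \<Longrightarrow> y j \<in> {-1, 1}" and coll: "collapsing (word y (i - int k) k)"
  shows "compatible y i = run (word y (i - int k) k) ` cube d"
proof -
  have signs: "set (word y (i - int (l + m)) l) \<subseteq> {-1, 1}" for l m
    using word_in_cube[of "i - int (l + m)" l y] y by (simp add: cube_def)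
  have split: "word y (i - int (l + m)) (l + m) = word y (i - int (l + m)) l @ word y (i - int m) m" for l m
    using word_add[of y "i - int (l + m)" l m] by simp
  have "run (word y (i - int k) k) ` cube d \<subseteq> run (word y (i - int j) j) ` cube d" for j
  proof (cases "j \<le> k")
    case True
    then have "word y (i - int k) k = word y (i - int k) (k - j) @ word y (i - int j) j"
      using split[of "k - j" j] by simp
    moreover have "run (word y (i - int k) (k - j)) ` cube d \<subseteq> cube d"
      using True signs[of "k - j" j] run_in_cube by (simp add: image_subset_iff)
    ultimately show ?thesis by (simp only: run_append_image image_mono)
  next
    case False
    then have "word y (i - int j) j = word y (i - int j) (j - k) @ word y (i - int k) k"
      using split[of "j - k" k] by simp
    then show ?thesis
      using collapsing_prepend(2)[OF coll, of "word y (i - int j) (j - k)"] signs[of "j - k" k] False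
      by simp
  qed
  then show ?thesis unfolding compatible_def by blast
qed

lemma compatible_step:
  assumes y: "\<And>j. y j \<in> {-1, 1}" and coll: "collapsing (word y (i - int k) k)"
  shows "compatible y (i + 1) = step \<phi> (y i) ` compatible y i"
proof -
  have w: "word y (i + 1 - int (Suc k)) (Suc k) = word y (i - int k) k @ [y i]"
    by (simp add: word_Suc)
  then have "collapsing (word y (i + 1 - int (Suc k)) (Suc k))"
    using collapsing_append[OF coll, of "[y i]"] y[of i] by simp
  from compatible_eq_image[OF y this] show ?thesis
    unfolding w compatible_eq_image[OF y coll] by (simp add: image_image)
qed

lemma measurable_compatible:
  assumes y: "\<And>j. j < i \<Longrightarrow> y j \<in> measurable M sign_space"
  shows "(\<lambda>\<omega>. compatible (\<lambda>j. y j \<omega>) i) \<in> measurable M (count_space (Pow (cube d)))"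
proof (subst measurable_count_space_eq2, simp add: finite_cube, intro conjI ballI)
  show "(\<lambda>\<omega>. compatible (\<lambda>j. y j \<omega>) i) \<in> space M \<rightarrow> Pow (cube d)"
    using compatible_subset by blast
  fix A assume A: "A \<in> Pow (cube d)"
  let ?w = "\<lambda>\<omega> k. word (\<lambda>j. y j \<omega>) (i - int k) k"
  have "{\<omega> \<in> space M. a \<in> run (?w \<omega> k) ` cube d} \<in> sets M" for a k
    using measurable_sets[OF measurable_word[of "i - int k" k y M], OF y, of "{u. a \<in> run u ` cube d}"]
    by (simp add: vimage_def Int_def conj_commute)
  then have "{\<omega> \<in> space M. \<forall>a\<in>cube d. a \<in> A \<longleftrightarrow> (\<forall>k. a \<in> run (?w \<omega> k) ` cube d)} \<in> sets M"
    by (intro sets.sets_Collect_finite_All sets.sets_Collect_countable_All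
        sets.sets_Collect(5) finite_cube) (simp add: finite_cube)
  also have "{\<omega> \<in> space M. \<forall>a\<in>cube d. a \<in> A \<longleftrightarrow> (\<forall>k. a \<in> run (?w \<omega> k) ` cube d)} =
      (\<lambda>\<omega>. compatible (\<lambda>j. y j \<omega>) i) -` {A} \<inter> space M"
    using A compatible_subset[of _ i] by (auto simp: compatible_def set_eq_iff) blast+
  finally show "(\<lambda>\<omega>. compatible (\<lambda>j. y j \<omega>) i) -` {A} \<inter> space M \<in> sets M" .
qed

text \<open>Time \<open>n\<close> in the governed chain means that the output at time \<open>n\<close> has been used, hence \<open>n + 1\<close>. The default
value is taken only when the past contains no collapsing word, which is a null event.\<close>

definition chain :: "(int \<Rightarrow> int) \<Rightarrow> int \<Rightarrow> int list set" where
  "chain y n = (if compatible y (n + 1) \<in> recurrent_class d \<phi> then compatible y (n + 1)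
     else (SOME A. A \<in> recurrent_class d \<phi>))"

lemma default_in_class: "(SOME A. A \<in> recurrent_class d \<phi>) \<in> recurrent_class d \<phi>"
proof -
  obtain u where "collapsing u" using ex_collapsing by blast
  then show ?thesis by (rule someI[of "\<lambda>A. A \<in> recurrent_class d \<phi>", OF image_collapsing_recurrent])
qed

lemma chain_cong: "(\<And>j. j \<le> n \<Longrightarrow> x j = y j) \<Longrightarrow> chain x n = chain y n"
  using compatible_cong[of "n + 1" x y] by (simp add: chain_def)

lemma chain_eq_compatible:
  assumes "\<And>j. y j \<in> {-1, 1}" "collapsing (word y (n + 1 - int k) k)"
  shows "chain y n = compatible y (n + 1)"
  using compatible_eq_image[of "n + 1" y k] image_collapsing_recurrent assms by (simp add: chain_def)

lemma measurable_chain: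
  assumes "\<And>j. j \<le> n \<Longrightarrow> y j \<in> measurable M sign_space"
  shows "(\<lambda>\<omega>. chain (\<lambda>j. y j \<omega>) n) \<in> measurable M (count_space (recurrent_class d \<phi>))"
proof -
  have "(\<lambda>\<omega>. compatible (\<lambda>j. y j \<omega>) (n + 1)) \<in> measurable M (count_space (Pow (cube d)))"
    by (rule measurable_compatible) (use assms in auto)
  then show ?thesis
    unfolding chain_def
    by (rule measurable_compose)
      (simp add: default_in_class)
qed

lemma pmf_set_kernel: "pmf (set_kernel \<phi> A) B = card {\<alpha> \<in> {-1, 1}. step \<phi> \<alpha> ` A = B} / 2"
  by (simp add: set_kernel_def pmf_map measure_pmf_of_set vimage_def Int_def)

lemma collapsing_fails_tendsto_0:
  assumes coin: "coin_tossing P \<eta>"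
  shows "(\<lambda>k. measure P {\<omega> \<in> space P. \<not> collapsing (word (\<lambda>j. \<eta> j \<omega>) (i - int k) k)}) \<longlonglongrightarrow> 0"
proof -
  obtain w where w: "collapsing w" using ex_collapsing by blast
  then have wl: "w \<in> cube (length w)" by (auto simp: collapsing_def cube_def)
  have "card {v \<in> cube k. \<not> collapsing v} \<le> card {v \<in> cube k. \<not> sublist w v}" for k
  proof (rule card_mono)
    show "{v \<in> cube k. \<not> collapsing v} \<subseteq> {v \<in> cube k. \<not> sublist w v}"
      using collapsing_sublist[OF w] by (auto simp: cube_def)
  qed (simp add: finite_cube)
  then have le: "real (card {v \<in> cube k. \<not> collapsing v}) / 2 ^ k \<le>
      card {v \<in> cube k. \<not> sublist w v} / 2 ^ k" for k
    by (intro divide_right_mono) auto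
  have eq: "measure P {\<omega> \<in> space P. \<not> collapsing (word (\<lambda>j. \<eta> j \<omega>) (i - int k) k)} =
      card {v \<in> cube k. \<not> collapsing v} / 2 ^ k" for k
    by (rule coin_prob_word_in[OF coin, of "\<lambda>v. \<not> collapsing v"])
  show ?thesis
    unfolding eq
    by (rule tendsto_sandwich[OF _ _ tendsto_const fraction_words_avoiding_tendsto_0[OF wl]])
      (use le in auto)
qed

lemma AE_collapsing:
  assumes coin: "coin_tossing P \<eta>"
  shows "AE \<omega> in P. \<exists>k. collapsing (word (\<lambda>j. \<eta> j \<omega>) (i - int k) k)"
proof -
  interpret prob_space P using coin by (simp add: coin_tossing_def)
  let ?bad = "\<lambda>k. {\<omega> \<in> space P. \<not> collapsing (word (\<lambda>j. \<eta> j \<omega>) (i - int k) k)}"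
  have bad: "?bad k \<in> events" for k by (rule coin_word_event[OF coin, of "\<lambda>v. \<not> collapsing v"])
  have "prob (\<Inter>k. ?bad k) \<le> prob (?bad k)" for k
    using bad by (intro finite_measure_mono) auto
  then have "prob (\<Inter>k. ?bad k) \<le> 0"
    by (intro LIMSEQ_le_const[OF collapsing_fails_tendsto_0[OF coin]]) blast
  then have "(\<Inter>k. ?bad k) \<in> null_sets P"
    using bad by (intro null_setsI) (auto simp: emeasure_eq_measure measure_le_0_iff)
  then show ?thesis by (rule AE_I') auto
qed

text \<open>The Markov property holds because the set at time \<open>n\<close> is a function of the outputs up to \<open>n\<close>, while the
next step uses the independent output at \<open>n + 1\<close>.\<close>

theorem governed_chain_chain:
  assumes coin: "coin_tossing P \<eta>"
  shows "governed_chain P d \<phi> \<eta> (\<lambda>n \<omega>. chain (\<lambda>j. \<eta> j \<omega>) n)"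
proof -
  interpret prob_space P using coin by (simp add: coin_tossing_def)
  define X where "X n \<omega> = chain (\<lambda>j. \<eta> j \<omega>) n" for n \<omega>
  let ?C = "recurrent_class d \<phi>"
  have X: "X n \<in> measurable P (count_space ?C)" for n
    unfolding X_def by (rule measurable_chain) (rule coin_measurable[OF coin])
  have rec: "AE \<omega> in P. X n \<omega> = step \<phi> (\<eta> n \<omega>) ` X (n - 1) \<omega>" for n
    using AE_collapsing[OF coin, of n] AE_space
  proof eventually_elim
    case (elim \<omega>)
    let ?y = "\<lambda>j. \<eta> j \<omega>"
    have y: "?y j \<in> {-1, 1}" for j using elim coin_sign[OF coin] by blast
    obtain k where k: "collapsing (word ?y (n - int k) k)" using elim by blast
    have "word ?y (n + 1 - int (Suc k)) (Suc k) = word ?y (n - int k) k @ [?y n]"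
      by (simp add: word_Suc)
    then have k': "collapsing (word ?y (n + 1 - int (Suc k)) (Suc k))"
      using collapsing_append[OF k, of "[?y n]"] y[of n] by simp
    have "chain ?y n = compatible ?y (n + 1)" by (rule chain_eq_compatible[OF y k'])
    also have "\<dots> = step \<phi> (?y n) ` compatible ?y n" by (rule compatible_step[OF y k])
    also have "compatible ?y n = chain ?y (n - 1)"
      using chain_eq_compatible[of ?y "n - 1" k] y k by simp
    finally show ?case by (simp add: X_def)
  qed
  have markov: "prob {\<omega>\<in>space P. \<forall>k\<in>{m..n + 1}. X k \<omega> = x k} =
        prob {\<omega>\<in>space P. \<forall>k\<in>{m..n}. X k \<omega> = x k} * pmf (set_kernel \<phi> (x n)) (x (n + 1))"
    if mn: "m \<le> n" for m n x
  proof -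
    let ?L = "Pi\<^sub>M {..n} (\<lambda>_. sign_space)"
    define E where "E = {y \<in> space ?L. \<forall>k\<in>{m..n}. chain y k = x k}"
    have chain_L: "(\<lambda>y. chain (\<lambda>j. y j) k) \<in> measurable ?L (count_space ?C)" if "k \<in> {m..n}" for k
      by (rule measurable_chain) (use that in \<open>measurable; simp\<close>)
    have E: "E \<in> sets ?L"
      unfolding E_def
    proof (intro sets.sets_Collect_finite_All)
      fix k assume k: "k \<in> {m..n}"
      have "(\<lambda>y. chain y k) \<in> measurable ?L (count_space UNIV)"
        using chain_L[OF k] by (rule measurable_compose) simp
      from measurable_sets[OF this, of "{x k}"] show "{y \<in> space ?L. chain y k = x k} \<in> sets ?L"
        by (simp add: vimage_def Int_def conj_commute)
    qed simp
    have inE: "(\<lambda>j\<in>{..n}. \<eta> j \<omega>) \<in> E \<longleftrightarrow> (\<forall>k\<in>{m..n}. X k \<omega> = x k)" if "\<omega> \<in> space P" for \<omega>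
    proof -
      have "chain (\<lambda>j\<in>{..n}. \<eta> j \<omega>) k = X k \<omega>" if "k \<in> {m..n}" for k
        unfolding X_def by (rule chain_cong) (use that in auto)
      moreover have "(\<lambda>j\<in>{..n}. \<eta> j \<omega>) \<in> space ?L"
        using coin_sign[OF coin that] by (auto simp: space_PiM)
      ultimately show ?thesis by (simp add: E_def)
    qed
    let ?G = "{\<omega> \<in> space P. (\<lambda>j\<in>{..n}. \<eta> j \<omega>) \<in> E}"
    let ?S = "{\<alpha> \<in> {-1, 1}. step \<phi> \<alpha> ` x n = x (n + 1)}"
    have meas1: "{\<omega> \<in> space P. \<forall>k\<in>{m..n + 1}. X k \<omega> = x k} \<in> events"
    proof (intro sets.sets_Collect_finite_All)
      fix k
      have "X k \<in> measurable P (count_space UNIV)" using X by (rule measurable_compose) simp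
      from measurable_sets[OF this, of "{x k}"] show "{\<omega> \<in> space P. X k \<omega> = x k} \<in> events"
        by (simp add: vimage_def Int_def conj_commute)
    qed simp
    have meas2: "{\<omega> \<in> space P. (\<lambda>j\<in>{..n}. \<eta> j \<omega>) \<in> E \<and> \<eta> (n + 1) \<omega> = \<alpha>} \<in> events" for \<alpha>
    proof (intro sets.sets_Collect_conj)
      have "(\<lambda>\<omega>. \<lambda>j\<in>{..n}. \<eta> j \<omega>) \<in> measurable P ?L"
        by (rule measurable_restrict) (rule coin_measurable[OF coin])
      from measurable_sets[OF this E] show "{\<omega> \<in> space P. (\<lambda>j\<in>{..n}. \<eta> j \<omega>) \<in> E} \<in> events"
        by (simp add: vimage_def Int_def conj_commute)
      have "\<eta> (n + 1) \<in> measurable P (count_space UNIV)"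
        using coin_measurable[OF coin] by (rule measurable_compose) simp
      from measurable_sets[OF this, of "{\<alpha>}"] show "{\<omega> \<in> space P. \<eta> (n + 1) \<omega> = \<alpha>} \<in> events"
        by (simp add: vimage_def Int_def conj_commute)
    qed
    have "prob {\<omega>\<in>space P. \<forall>k\<in>{m..n + 1}. X k \<omega> = x k} =
        prob (\<Union>\<alpha>\<in>?S. {\<omega> \<in> space P. (\<lambda>j\<in>{..n}. \<eta> j \<omega>) \<in> E \<and> \<eta> (n + 1) \<omega> = \<alpha>})"
    proof (rule finite_measure_eq_AE)
      show "AE \<omega> in P. (\<omega> \<in> {\<omega>\<in>space P. \<forall>k\<in>{m..n + 1}. X k \<omega> = x k}) =
          (\<omega> \<in> (\<Union>\<alpha>\<in>?S. {\<omega> \<in> space P. (\<lambda>j\<in>{..n}. \<eta> j \<omega>) \<in> E \<and> \<eta> (n + 1) \<omega> = \<alpha>}))"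
        using rec[of "n + 1"] AE_space
      proof eventually_elim
        case (elim \<omega>)
        have "\<eta> (n + 1) \<omega> \<in> {-1, 1}" using coin_sign[OF coin] elim by blast
        moreover have "{m..n + 1} = insert (n + 1) {m..n}" using mn by auto
        ultimately show ?case using elim mn inE[of \<omega>] by auto
      qed
      show "(\<Union>\<alpha>\<in>?S. {\<omega> \<in> space P. (\<lambda>j\<in>{..n}. \<eta> j \<omega>) \<in> E \<and> \<eta> (n + 1) \<omega> = \<alpha>}) \<in> events"
        using meas2 by (intro sets.finite_UN) auto
    qed (rule meas1)
    also have "\<dots> = (\<Sum>\<alpha>\<in>?S. prob {\<omega> \<in> space P. (\<lambda>j\<in>{..n}. \<eta> j \<omega>) \<in> E \<and> \<eta> (n + 1) \<omega> = \<alpha>})"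
      using meas2 by (intro finite_measure_finite_Union) (auto simp: disjoint_family_on_def)
    also have "\<dots> = (\<Sum>\<alpha>\<in>?S. prob ?G / 2)"
      by (intro sum.cong refl coin_next_independent[OF coin E]) auto
    also have "\<dots> = prob ?G * pmf (set_kernel \<phi> (x n)) (x (n + 1))"
      by (simp add: pmf_set_kernel)
    also have "?G = {\<omega>\<in>space P. \<forall>k\<in>{m..n}. X k \<omega> = x k}" using inE by blast
    finally show ?thesis .
  qed
  have "governed_chain P d \<phi> \<eta> X"
    using coin X rec markov countable_recurrent_class prob_space_axioms
    by (simp add: governed_chain_def markov_chain_on_def)
  then show ?thesis by (simp add: X_def[abs_def])
qed

text \<open>By its defining property, \<open>F\<close> yields every chain governed by \<open>\<eta>\<close>, in particular the chain of compatible sets.\<close>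

corollary past_map_eq_compatible:
  assumes coin: "coin_tossing P \<eta>" and F: "past_map d \<phi> F"
  shows "AE \<omega> in P. F (past n (\<lambda>k. \<eta> k \<omega>)) = compatible (\<lambda>j. \<eta> j \<omega>) (n + 1)"
  using past_map_governed_chain[OF F governed_chain_chain[OF coin]]
    AE_collapsing[OF coin, of "n + 1"] AE_space
proof eventually_elim
  case (elim \<omega>)
  then obtain k where "collapsing (word (\<lambda>j. \<eta> j \<omega>) (n + 1 - int k) k)" by blast
  then have "chain (\<lambda>j. \<eta> j \<omega>) n = compatible (\<lambda>j. \<eta> j \<omega>) (n + 1)"
    using elim coin_sign[OF coin] by (intro chain_eq_compatible) blast+
  then show ?case using elim by metis
qed

end

section \<open>The conditional law\<close>

text \<open>The measures with densities \<open>f\<close> and \<open>g\<close>, transported by \<open>H\<close>, agree on cylinders and hence everywhere.\<close>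

lemma set_integral_eqI_cylinders:
  fixes f g :: "'w \<Rightarrow> real"
  assumes P: "prob_space P" and H: "H \<in> measurable P sequence_space"
    and f: "f \<in> borel_measurable P" "\<And>\<omega>. 0 \<le> f \<omega>" "\<And>\<omega>. f \<omega> \<le> 1"
    and g: "g \<in> borel_measurable P" "\<And>\<omega>. 0 \<le> g \<omega>" "\<And>\<omega>. g \<omega> \<le> 1"
    and eq: "\<And>k v. (\<integral>\<omega>. (f \<omega> - g \<omega>) * indicator (cylinder k v) (H \<omega>) \<partial>P) = 0"
    and A: "A \<in> sets sequence_space"
  shows "(\<integral>\<omega>. f \<omega> * indicator A (H \<omega>) \<partial>P) = (\<integral>\<omega>. g \<omega> * indicator A (H \<omega>) \<partial>P)"
proof -
  interpret prob_space P by (rule P)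
  have int: "integrable P (\<lambda>\<omega>. h \<omega> * indicator C (H \<omega>))"
    if "h \<in> borel_measurable P" "\<And>\<omega>. 0 \<le> h \<omega>" "\<And>\<omega>. h \<omega> \<le> 1" "C \<in> sets sequence_space"
    for h :: "'w \<Rightarrow> real" and C
  proof (rule integrable_const_bound[where B = 1])
    have "(\<lambda>\<omega>. indicator C (H \<omega>) :: real) \<in> borel_measurable P"
      by (rule measurable_compose[OF H]) (use that(4) in simp)
    then show "(\<lambda>\<omega>. h \<omega> * indicator C (H \<omega>)) \<in> borel_measurable P"
      using that(1) by (rule borel_measurable_times[rotated])
  qed (use that in \<open>auto simp: indicator_def\<close>)
  define \<mu> where "\<mu> h = distr (density P (\<lambda>\<omega>. ennreal (h \<omega>))) sequence_space H" for h :: "'w \<Rightarrow> real"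
  have \<mu>: "emeasure (\<mu> h) C = ennreal (\<integral>\<omega>. h \<omega> * indicator C (H \<omega>) \<partial>P)"
    if "h \<in> borel_measurable P" "\<And>\<omega>. 0 \<le> h \<omega>" "\<And>\<omega>. h \<omega> \<le> 1" "C \<in> sets sequence_space"
    for h C
  proof -
    have H': "H \<in> measurable (density P (\<lambda>\<omega>. ennreal (h \<omega>))) sequence_space" using H by simp
    have "emeasure (\<mu> h) C = emeasure (density P (\<lambda>\<omega>. ennreal (h \<omega>))) (H -` C \<inter> space P)"
      unfolding \<mu>_def by (simp add: emeasure_distr[OF H' that(4)])
    also have "\<dots> = (\<integral>\<^sup>+\<omega>. ennreal (h \<omega>) * indicator (H -` C \<inter> space P) \<omega> \<partial>P)"
      using that(1) measurable_sets[OF H that(4)] by (intro emeasure_density) auto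
    also have "\<dots> = (\<integral>\<^sup>+\<omega>. ennreal (h \<omega> * indicator C (H \<omega>)) \<partial>P)"
      by (intro nn_integral_cong) (auto simp: indicator_def)
    also have "\<dots> = ennreal (\<integral>\<omega>. h \<omega> * indicator C (H \<omega>) \<partial>P)"
      using that by (intro nn_integral_eq_integral int) (auto simp: indicator_def)
    finally show ?thesis .
  qed
  have "\<mu> f = \<mu> g"
  proof (rule sequence_measure_eqI)
    have "emeasure (\<mu> f) (space (\<mu> f)) \<noteq> \<infinity>"
      using \<mu>[OF f, of "space sequence_space"] by (simp add: \<mu>_def)
    then show "finite_measure (\<mu> f)" by (rule finite_measureI)
    show "emeasure (\<mu> f) (cylinder k v) = emeasure (\<mu> g) (cylinder k v)" for k v
    proof -
      have "(\<integral>\<omega>. f \<omega> * indicator (cylinder k v) (H \<omega>) \<partial>P) - (\<integral>\<omega>. g \<omega> * indicator (cylinder k v) (H \<omega>) \<partial>P)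
          = (\<integral>\<omega>. (f \<omega> - g \<omega>) * indicator (cylinder k v) (H \<omega>) \<partial>P)"
        by (simp add: left_diff_distrib int[OF f cylinder_in_sets] int[OF g cylinder_in_sets])
      then show ?thesis using eq[of k v] by (simp add: \<mu>[OF f cylinder_in_sets] \<mu>[OF g cylinder_in_sets])
    qed
  qed (simp_all add: \<mu>_def)
  then have "ennreal (\<integral>\<omega>. f \<omega> * indicator A (H \<omega>) \<partial>P) = ennreal (\<integral>\<omega>. g \<omega> * indicator A (H \<omega>) \<partial>P)"
    using \<mu>[OF f A] \<mu>[OF g A] by simp
  then show ?thesis
    using f(2) g(2) by (subst (asm) ennreal_inj) (auto intro!: integral_nonneg_AE simp: indicator_def)
qed

locale feedback_coin = feedback d \<phi> + prob_space P
  for d \<phi> and P :: "'w measure" +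
  fixes \<epsilon> :: "int \<Rightarrow> 'w \<Rightarrow> int"
  assumes coin: "coin_tossing P \<epsilon>"
begin

definition \<eta> :: "int \<Rightarrow> 'w \<Rightarrow> int" where
  "\<eta> j \<omega> = Phi d \<phi> (\<lambda>k. \<epsilon> k \<omega>) j"

definition state_at :: "int \<Rightarrow> 'w \<Rightarrow> int list" where
  "state_at i \<omega> = state (\<lambda>k. \<epsilon> k \<omega>) i"

abbreviation out_word :: "int \<Rightarrow> nat \<Rightarrow> 'w \<Rightarrow> int list" where
  "out_word i l \<omega> \<equiv> word (\<lambda>j. \<eta> j \<omega>) i l"

lemma \<epsilon>_sign: "\<omega> \<in> space P \<Longrightarrow> \<epsilon> j \<omega> \<in> {-1, 1}"
  by (rule coin_sign[OF coin])

lemma \<eta>_sign: "\<omega> \<in> space P \<Longrightarrow> \<eta> j \<omega> \<in> {-1, 1}"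
  unfolding \<eta>_def by (rule Phi_sign) (rule \<epsilon>_sign)

lemma state_at_in_cube: "\<omega> \<in> space P \<Longrightarrow> state_at i \<omega> \<in> cube d"
  unfolding state_at_def by (rule state_in_cube) (rule \<epsilon>_sign)

lemma state_at_run: "\<omega> \<in> space P \<Longrightarrow> state_at (i + int l) \<omega> = run (out_word i l \<omega>) (state_at i \<omega>)"
  unfolding state_at_def \<eta>_def by (rule state_run) (rule \<epsilon>_sign)

lemma measurable_state_at: "state_at i \<in> measurable P (count_space UNIV)"
  unfolding state_at_def[abs_def] state_def by (rule measurable_word) (rule coin_measurable[OF coin])

lemma \<eta>_measurable: "\<eta> j \<in> measurable P sign_space"
proof -
  have "(\<lambda>\<omega>. \<phi> (state_at j \<omega>) * \<epsilon> j \<omega>) \<in> measurable P (count_space UNIV)"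
    by (rule measurable_compose_countable[where g = "state_at j", OF _ measurable_state_at],
        rule measurable_compose[OF coin_measurable[OF coin]]) simp
  then have "\<eta> j \<in> measurable P (count_space UNIV)"
    by (simp add: \<eta>_def[abs_def] Phi_eq state_at_def)
  then show ?thesis
    using \<eta>_sign[of _ j] by (subst measurable_count_space_eq2) (auto intro: measurable_sets)
qed

lemma out_word_in_cube: "\<omega> \<in> space P \<Longrightarrow> out_word i l \<omega> \<in> cube l"
  by (rule word_in_cube) (rule \<eta>_sign)

lemma measurable_out_word: "out_word i l \<in> measurable P (count_space UNIV)"
  by (rule measurable_word) (rule \<eta>_measurable)

lemma out_event: "{\<omega> \<in> space P. Q (state_at i \<omega>) \<and> R (out_word i' l \<omega>)} \<in> events"
proof (rule sets.sets_Collect_conj)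
  show "{\<omega> \<in> space P. Q (state_at i \<omega>)} \<in> events"
    using measurable_sets[OF measurable_state_at, of "Collect Q" i]
    by (simp add: vimage_def Int_def conj_commute)
  show "{\<omega> \<in> space P. R (out_word i' l \<omega>)} \<in> events"
    using measurable_sets[OF measurable_out_word, of "Collect R" i' l]
    by (simp add: vimage_def Int_def conj_commute)
qed

lemma prob_state_out_word:
  assumes u: "u \<in> cube l"
  shows "prob {\<omega> \<in> space P. Q (state_at i \<omega>) \<and> out_word i l \<omega> = u} =
    card {a \<in> cube d. Q a} / 2 ^ (d + l)"
proof -
  have single: "prob {\<omega> \<in> space P. state_at i \<omega> = a \<and> out_word i l \<omega> = u} = 1 / 2 ^ (d + l)"
    if a: "a \<in> cube d" for a
  proof -
    obtain v where v: "v \<in> cube (d + l)"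
      "\<And>x. (\<forall>j. x j \<in> {-1, 1}) \<Longrightarrow>
        (state x i = a \<and> word (Phi d \<phi> x) i l = u \<longleftrightarrow> word x (i - int d) (d + l) = v)"
      using state_Phi_word_determined[OF a u] by blast
    have "state_at i \<omega> = a \<and> out_word i l \<omega> = u \<longleftrightarrow> word (\<lambda>k. \<epsilon> k \<omega>) (i - int d) (d + l) = v"
      if "\<omega> \<in> space P" for \<omega>
      unfolding state_at_def \<eta>_def by (rule v(2)) (use \<epsilon>_sign[OF that] in blast)
    then have "{\<omega> \<in> space P. state_at i \<omega> = a \<and> out_word i l \<omega> = u} =
        {\<omega> \<in> space P. word (\<lambda>k. \<epsilon> k \<omega>) (i - int d) (d + l) = v}" by blast
    then show ?thesis by (simp add: coin_prob_word[OF coin v(1)])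
  qed
  have "{\<omega> \<in> space P. Q (state_at i \<omega>) \<and> out_word i l \<omega> = u} =
      (\<Union>a\<in>{a \<in> cube d. Q a}. {\<omega> \<in> space P. state_at i \<omega> = a \<and> out_word i l \<omega> = u})"
    using state_at_in_cube by blast
  also have "prob \<dots> = (\<Sum>a\<in>{a \<in> cube d. Q a}. prob {\<omega> \<in> space P. state_at i \<omega> = a \<and> out_word i l \<omega> = u})"
    using out_event[of "\<lambda>b. b = a" i "\<lambda>v. v = u" i l for a]
    by (intro finite_measure_finite_Union) (auto simp: finite_cube disjoint_family_on_def)
  also have "\<dots> = card {a \<in> cube d. Q a} / 2 ^ (d + l)" by (simp add: single)
  finally show ?thesis .
qed

lemma coin_tossing_\<eta>: "coin_tossing P \<eta>"
proof (rule coin_tossingI_prob_word[OF coin \<eta>_measurable])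
  show "prob {\<omega> \<in> space P. out_word i l \<omega> = u} = 1 / 2 ^ l" if "u \<in> cube l" for i l u
    using prob_state_out_word[OF that, of "\<lambda>_. True" i] by (simp add: card_cube power_add)
qed

text \<open>The state at time \<open>i\<close> is \<open>run s\<close> of the state at time \<open>i - l\<close>, which is uniform and independent of
the outputs in the window; and all fibres of \<open>run s\<close> have the same size.\<close>

lemma prob_state_after_collapse:
  assumes s: "collapsing s" "s \<in> cube l" and t: "t \<in> cube r"
  shows "prob {\<omega> \<in> space P. state_at i \<omega> \<in> B \<and> out_word (i - int l) (l + r) \<omega> = s @ t} =
    measure_pmf.prob (pmf_of_set (run s ` cube d)) B *
      prob {\<omega> \<in> space P. out_word (i - int l) (l + r) \<omega> = s @ t}"
proof -
  have st: "s @ t \<in> cube (l + r)" using s(2) t by (rule append_in_cube)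
  have len: "length s = l" using s(2) by (simp add: cube_def)
  have run: "state_at i \<omega> = run s (state_at (i - int l) \<omega>)"
    if "\<omega> \<in> space P" "out_word (i - int l) (l + r) \<omega> = s @ t" for \<omega>
  proof -
    have "out_word (i - int l) l \<omega> = s" using that(2) len by (simp add: word_add)
    then show ?thesis using state_at_run[OF that(1), of "i - int l" l] by simp
  qed
  have "{\<omega> \<in> space P. state_at i \<omega> \<in> B \<and> out_word (i - int l) (l + r) \<omega> = s @ t} =
      {\<omega> \<in> space P. run s (state_at (i - int l) \<omega>) \<in> B \<and> out_word (i - int l) (l + r) \<omega> = s @ t}"
    by (rule Collect_cong) (metis run)
  then have 1: "prob {\<omega> \<in> space P. state_at i \<omega> \<in> B \<and> out_word (i - int l) (l + r) \<omega> = s @ t} =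
      card {a \<in> cube d. run s a \<in> B} / 2 ^ (d + (l + r))"
    by (simp only: prob_state_out_word[OF st, of "\<lambda>a. run s a \<in> B"])
  have 2: "prob {\<omega> \<in> space P. out_word (i - int l) (l + r) \<omega> = s @ t} = 1 / 2 ^ (l + r)"
    using prob_state_out_word[OF st, of "\<lambda>_. True" "i - int l"] by (simp add: card_cube power_add)
  let ?I = "run s ` cube d"
  have "{a \<in> cube d. run s a \<in> B} = (\<Union>y\<in>?I \<inter> B. fibre s y)" by (auto simp: fibre_def)
  also have "card \<dots> = (\<Sum>y\<in>?I \<inter> B. card (fibre s y))"
    by (rule card_UN_disjoint)
      (auto simp: finite_cube fibre_def)
  finally have "card {a \<in> cube d. run s a \<in> B} * rank = (\<Sum>y\<in>?I \<inter> B. card (fibre s y) * rank)"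
    by (simp add: sum_distrib_right)
  also have "\<dots> = card (?I \<inter> B) * 2 ^ d" using card_fibre_collapsing[OF s(1)] by simp
  finally have "real (card {a \<in> cube d. run s a \<in> B} * rank) = real (card (?I \<inter> B) * 2 ^ d)"
    by (rule arg_cong)
  then have "real (card {a \<in> cube d. run s a \<in> B}) * real rank = real (card (?I \<inter> B)) * 2 ^ d"
    by simp
  then have 3: "real (card {a \<in> cube d. run s a \<in> B}) =
      real (card (?I \<inter> B)) / real rank * 2 ^ d"
    using rank_pos by (simp add: field_simps)
  have "?I \<noteq> {}" using s(1) rank_pos by (auto simp: collapsing_def)
  then have "measure (measure_pmf (pmf_of_set ?I)) B = real (card (?I \<inter> B)) / real rank"
    using s(1) by (simp add: measure_pmf_of_set finite_cube collapsing_def)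
  then show ?thesis unfolding 1 2 3 by (simp add: power_add)
qed

definition unif_compatible :: "int \<Rightarrow> int list set \<Rightarrow> 'w \<Rightarrow> real" where
  "unif_compatible i B \<omega> = measure_pmf.prob (pmf_of_set (compatible (\<lambda>j. \<eta> j \<omega>) i)) B"

lemma measurable_unif_compatible: "unif_compatible i B \<in> borel_measurable P"
  unfolding unif_compatible_def[abs_def]
  by (rule measurable_compose[OF measurable_compatible]) (simp_all add: \<eta>_measurable)

text \<open>The claim is that the integral of this difference over every event of the output \<open>\<sigma>\<close>-algebra is \<open>0\<close>.\<close>

definition gap :: "int \<Rightarrow> int list set \<Rightarrow> 'w \<Rightarrow> real" where
  "gap i B \<omega> = indicator B (state_at i \<omega>) - unif_compatible i B \<omega>"

lemma abs_gap_le_1: "\<bar>gap i B \<omega>\<bar> \<le> 1"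
  using measure_pmf.prob_le_1[of "pmf_of_set (compatible (\<lambda>j. \<eta> j \<omega>) i)" B]
  by (auto simp: gap_def unif_compatible_def indicator_def)

lemma measurable_indicator_state_at: "(\<lambda>\<omega>. indicator B (state_at i \<omega>) :: real) \<in> borel_measurable P"
  by (rule measurable_compose[OF measurable_state_at]) simp

lemma measurable_gap: "gap i B \<in> borel_measurable P"
  unfolding gap_def[abs_def]
  by (intro borel_measurable_diff measurable_indicator_state_at measurable_unif_compatible)

lemma integrable_gap: "E \<in> events \<Longrightarrow> integrable P (\<lambda>\<omega>. gap i B \<omega> * indicator E \<omega>)"
  using abs_gap_le_1
  by (intro integrable_const_bound[where B = 1] borel_measurable_times measurable_gap)
    (auto simp: indicator_def)

lemma integral_gap_collapsed:
  assumes s: "collapsing s" "s \<in> cube l" and t: "t \<in> cube r"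
  shows "(\<integral>\<omega>. gap i B \<omega> * indicator {\<omega> \<in> space P. out_word (i - int l) (l + r) \<omega> = s @ t} \<omega> \<partial>P) = 0"
proof -
  let ?E = "{\<omega> \<in> space P. out_word (i - int l) (l + r) \<omega> = s @ t}"
  let ?F = "{\<omega> \<in> space P. state_at i \<omega> \<in> B \<and> out_word (i - int l) (l + r) \<omega> = s @ t}"
  let ?c = "measure_pmf.prob (pmf_of_set (run s ` cube d)) B"
  have E: "?E \<in> events"
    using out_event[of "\<lambda>_. True" i "\<lambda>v. v = s @ t" "i - int l" "l + r"] by simp
  have F: "?F \<in> events" by (rule out_event[of "\<lambda>a. a \<in> B" i "\<lambda>v. v = s @ t"])
  have c: "unif_compatible i B \<omega> = ?c" if "\<omega> \<in> ?E" for \<omega>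
  proof -
    have "out_word (i - int l) l \<omega> = s" using that s(2) by (simp add: word_add cube_def)
    then show ?thesis
      using compatible_eq_image[of i "\<lambda>j. \<eta> j \<omega>" l] \<eta>_sign that s(1) by (simp add: unif_compatible_def)
  qed
  have "(\<integral>\<omega>. gap i B \<omega> * indicator ?E \<omega> \<partial>P) = (\<integral>\<omega>. indicator ?F \<omega> - ?c * indicator ?E \<omega> \<partial>P)"
    using c by (intro Bochner_Integration.integral_cong) (auto simp: gap_def indicator_def)
  also have "\<dots> = prob ?F - ?c * prob ?E"
    using E F by (subst Bochner_Integration.integral_diff) (auto simp: emeasure_eq_measure)
  also have "\<dots> = 0" using prob_state_after_collapse[OF s t, of i B] by simp
  finally show ?thesis .
qed

text \<open>The event splits according to the word \<open>s @ t\<close> seen in the window. The parts with \<open>s\<close> collapsing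
contribute \<open>0\<close>; on the remaining part the integrand is at most \<open>1\<close> in absolute value.\<close>

lemma abs_integral_gap_le:
  "\<bar>\<integral>\<omega>. gap i B \<omega> * indicator {\<omega> \<in> space P. Q (out_word (i - int l) (l + r) \<omega>)} \<omega> \<partial>P\<bar>
    \<le> prob {\<omega> \<in> space P. \<not> collapsing (out_word (i - int l) l \<omega>)}"
proof -
  let ?w = "out_word (i - int l) (l + r)"
  let ?E = "{\<omega> \<in> space P. Q (?w \<omega>)}"
  let ?U = "{u \<in> cube (l + r). Q u \<and> collapsing (take l u)}"
  let ?bad = "{\<omega> \<in> space P. \<not> collapsing (out_word (i - int l) l \<omega>)}"
  let ?e = "\<lambda>u. {\<omega> \<in> space P. ?w \<omega> = u}"
  have take_w: "take l (?w \<omega>) = out_word (i - int l) l \<omega>" for \<omega> by (simp add: word_add)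
  have finU: "finite ?U" by (simp add: finite_cube)
  have e: "?e u \<in> events" for u
    using out_event[of "\<lambda>_. True" i "\<lambda>v. v = u" "i - int l" "l + r"] by (simp only: simp_thms)
  have bad: "?bad \<in> events"
    using out_event[of "\<lambda>_. True" i "\<lambda>v. \<not> collapsing v" "i - int l" l]
    by (simp only: simp_thms)
  have "?E \<in> events"
    using out_event[of "\<lambda>_. True" i Q "i - int l" "l + r"] by (simp only: simp_thms)
  then have E_bad: "?E \<inter> ?bad \<in> events" using bad by (rule sets.Int)
  have split: "indicator ?E \<omega> = (\<Sum>u\<in>?U. indicator (?e u) \<omega>) + (indicator (?E \<inter> ?bad) \<omega> :: real)"
    if "\<omega> \<in> space P" for \<omega>
  proof -
    have "(\<Sum>u\<in>?U. indicator (?e u) \<omega>) = (\<Sum>u\<in>?U. if ?w \<omega> = u then 1 else 0 :: real)"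
      by (rule sum.cong[OF refl]) (simp only: indicator_def of_bool_def mem_Collect_eq that simp_thms)
    also have "\<dots> = (if ?w \<omega> \<in> ?U then 1 else 0)" by (rule sum.delta'[OF finU])
    also have "\<dots> = (if Q (?w \<omega>) \<and> collapsing (out_word (i - int l) l \<omega>) then 1 else 0)"
      by (simp only: mem_Collect_eq take_w out_word_in_cube[OF that] simp_thms)
    finally have U: "(\<Sum>u\<in>?U. indicator (?e u) \<omega>) =
        (if Q (?w \<omega>) \<and> collapsing (out_word (i - int l) l \<omega>) then 1 else 0 :: real)" .
    show ?thesis
      unfolding U
      by (cases "Q (?w \<omega>)"; cases "collapsing (out_word (i - int l) l \<omega>)")
        (simp_all only: indicator_def of_bool_def mem_Collect_eq Int_iff that simp_thms if_True if_False
          add_0_left add_0_right)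
  qed
  have zero: "(\<integral>\<omega>. gap i B \<omega> * indicator (?e u) \<omega> \<partial>P) = 0" if u: "u \<in> ?U" for u
  proof -
    have "u \<in> cube (l + r)" using u by blast
    then obtain s t where st: "u = s @ t" "s \<in> cube l" "t \<in> cube r"
      by (rule cube_append_splitE)
    have "take l u = s" using st(1,2) by (simp add: cube_def)
    then have "collapsing s" using u by blast
    from integral_gap_collapsed[OF this st(2,3)] show ?thesis unfolding st(1) .
  qed
  have int_e: "integrable P (\<lambda>\<omega>. gap i B \<omega> * indicator (?e u) \<omega>)" for u
    by (rule integrable_gap[OF e])
  have int_bad: "integrable P (\<lambda>\<omega>. gap i B \<omega> * indicator (?E \<inter> ?bad) \<omega>)"
    by (rule integrable_gap[OF E_bad])
  have sum_0: "(\<Sum>u\<in>?U. \<integral>\<omega>. gap i B \<omega> * indicator (?e u) \<omega> \<partial>P) = 0"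
    by (rule sum.neutral) (rule ballI, rule zero)
  have "(\<integral>\<omega>. gap i B \<omega> * indicator ?E \<omega> \<partial>P) =
      (\<integral>\<omega>. (\<Sum>u\<in>?U. gap i B \<omega> * indicator (?e u) \<omega>) + gap i B \<omega> * indicator (?E \<inter> ?bad) \<omega> \<partial>P)"
    by (rule Bochner_Integration.integral_cong[OF refl])
      (simp only: split distrib_left sum_distrib_left)
  also have "\<dots> = (\<Sum>u\<in>?U. \<integral>\<omega>. gap i B \<omega> * indicator (?e u) \<omega> \<partial>P) +
      (\<integral>\<omega>. gap i B \<omega> * indicator (?E \<inter> ?bad) \<omega> \<partial>P)"
    unfolding Bochner_Integration.integral_add[OF Bochner_Integration.integrable_sum[OF int_e] int_bad]
      Bochner_Integration.integral_sum[OF int_e] ..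
  finally have reduce: "(\<integral>\<omega>. gap i B \<omega> * indicator ?E \<omega> \<partial>P) =
      (\<integral>\<omega>. gap i B \<omega> * indicator (?E \<inter> ?bad) \<omega> \<partial>P)"
    unfolding sum_0 add_0_left .
  have "\<bar>\<integral>\<omega>. gap i B \<omega> * indicator (?E \<inter> ?bad) \<omega> \<partial>P\<bar> \<le> (\<integral>\<omega>. \<bar>gap i B \<omega> * indicator (?E \<inter> ?bad) \<omega>\<bar> \<partial>P)" by (rule integral_abs_bound)
  also have "\<dots> \<le> (\<integral>\<omega>. indicator ?bad \<omega> \<partial>P)"
  proof (rule integral_mono)
    show "integrable P (\<lambda>\<omega>. \<bar>gap i B \<omega> * indicator (?E \<inter> ?bad) \<omega>\<bar>)"
      by (intro integrable_abs integrable_gap E_bad)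
    show "integrable P (\<lambda>\<omega>. indicator ?bad \<omega> :: real)" using bad by (simp add: emeasure_eq_measure)
    show "\<bar>gap i B \<omega> * indicator (?E \<inter> ?bad) \<omega>\<bar> \<le> indicator ?bad \<omega>" for \<omega>
      using abs_gap_le_1[of i B \<omega>] by (simp add: indicator_def abs_mult)
  qed
  also have "\<dots> = prob ?bad" using bad by simp
  finally show ?thesis unfolding reduce .
qed

text \<open>For large \<open>l\<close> the window of the cylinder lies inside the window that starts at \<open>i - l\<close>, and the
left-hand side of the previous estimate does not depend on \<open>l\<close>.\<close>

lemma integral_gap_cylinder:
  "(\<integral>\<omega>. gap i B \<omega> * indicator (cylinder k v) (\<lambda>j. \<eta> j \<omega>) \<partial>P) = 0"
proof -
  define r where "r = nat (int k - i)"
  let ?I = "\<integral>\<omega>. gap i B \<omega> * indicator (cylinder k v) (\<lambda>j. \<eta> j \<omega>) \<partial>P"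
  have "\<bar>?I\<bar> \<le> prob {\<omega> \<in> space P. \<not> collapsing (out_word (i - int l) l \<omega>)}" if l: "l \<ge> nat (i + int k)" for l
  proof -
    let ?Q = "\<lambda>u. take (2 * k) (drop (nat (- int k - (i - int l))) u) = v"
    have "out_word (- int k) (2 * k) \<omega> =
        take (2 * k) (drop (nat (- int k - (i - int l))) (out_word (i - int l) (l + r) \<omega>))" for \<omega>
      using l unfolding r_def by (intro word_subword) linarith+
    moreover have "(\<lambda>j. \<eta> j \<omega>) \<in> space sequence_space" if "\<omega> \<in> space P" for \<omega>
      using \<eta>_sign[OF that] by (auto simp: space_PiM)
    ultimately have "?I = (\<integral>\<omega>. gap i B \<omega> *
        indicator {\<omega> \<in> space P. ?Q (out_word (i - int l) (l + r) \<omega>)} \<omega> \<partial>P)"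
      by (intro Bochner_Integration.integral_cong) (simp_all add: cylinder_def indicator_def)
    then show ?thesis using abs_integral_gap_le[of i B ?Q l r] by simp
  qed
  then have "\<bar>?I\<bar> \<le> 0"
    by (intro LIMSEQ_le_const[OF collapsing_fails_tendsto_0[OF coin_tossing_\<eta>, of i]]) blast
  then show ?thesis by simp
qed

end

theorem theorem20:
  fixes P :: "'w measure" and \<epsilon> :: "int \<Rightarrow> 'w \<Rightarrow> int"
    and d :: nat and \<phi> :: "int list \<Rightarrow> int"
    and F :: "(int \<Rightarrow> int) \<Rightarrow> int list set" and n :: int
  assumes "d \<ge> 1"
    and "\<phi> \<in> cube d \<rightarrow> {-1, 1}"
    and "coin_tossing P \<epsilon>"
    and "past_map d \<phi> F"
  shows "cond_law P
           (\<lambda>\<omega>. map (\<lambda>k. \<epsilon> k \<omega>) [n - int d + 1..n]) (count_space UNIV)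
           (\<lambda>\<omega>. Phi d \<phi> (\<lambda>k. \<epsilon> k \<omega>)) (Pi\<^sub>M UNIV (\<lambda>_. count_space {-1, 1}))
           (\<lambda>\<omega>. measure_pmf (pmf_of_set (F (past n (Phi d \<phi> (\<lambda>k. \<epsilon> k \<omega>))))))"
proof -
  interpret prob_space P using assms(3) by (simp add: coin_tossing_def)
  interpret feedback_coin d \<phi> P \<epsilon>
    using assms(1-3) by unfold_locales auto
  let ?Z = "\<lambda>\<omega>. Phi d \<phi> (\<lambda>k. \<epsilon> k \<omega>)"
  let ?G = "vimage_algebra (space P) ?Z sequence_space"
  let ?\<kappa> = "\<lambda>\<omega>. measure_pmf (pmf_of_set (F (past n (?Z \<omega>))))"
  have Z_eq: "?Z = (\<lambda>\<omega> j. \<eta> j \<omega>)" by (simp add: \<eta>_def)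
  have Z_at: "(\<lambda>j. \<eta> j \<omega>) = ?Z \<omega>" for \<omega> by (simp add: \<eta>_def)
  have Y_eq: "(\<lambda>\<omega>. map (\<lambda>k. \<epsilon> k \<omega>) [n - int d + 1..n]) = state_at (n + 1)"
    by (simp add: state_at_def[abs_def] state_def map_upto_eq_word algebra_simps)
  have Z: "?Z \<in> measurable P sequence_space"
    unfolding Z_eq by (rule measurable_abs_UNIV) (rule \<eta>_measurable)
  have ZG: "?Z \<in> measurable ?G sequence_space"
    using measurable_space[OF Z] by (intro measurable_vimage_algebra1) auto
  have F_meas: "F \<in> measurable (Pi\<^sub>M {..0} (\<lambda>_. sign_space)) (count_space (recurrent_class d \<phi>))"
    using assms(4) by (simp add: past_map_def)
  have past_meas: "past n \<in> measurable sequence_space (Pi\<^sub>M {..0} (\<lambda>_. sign_space))"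
    unfolding past_def[abs_def] by measurable
  have \<kappa>: "?\<kappa> \<in> measurable ?G (prob_algebra (count_space UNIV))"
  proof (rule measurable_compose[OF ZG], rule measurable_compose[OF past_meas],
      rule measurable_compose[OF F_meas])
    show "(\<lambda>A. measure_pmf (pmf_of_set A)) \<in>
        measurable (count_space (recurrent_class d \<phi>)) (prob_algebra (count_space UNIV))"
      by (auto simp: space_prob_algebra measure_pmf.prob_space_axioms)
  qed
  have sub: "subalgebra P ?G"
    using measurable_sets[OF Z] measurable_space[OF Z]
    by (auto simp: subalgebra_def sets_vimage_algebra2)
  interpret G: finite_measure_subalgebra P ?G
    by unfold_locales (rule sub)
  have "AE \<omega> in P. real_cond_exp P ?G (indicator (state_at (n + 1) -` B \<inter> space P)) \<omega> = measure (?\<kappa> \<omega>) B"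
    for B :: "int list set"
  proof (rule G.real_cond_exp_charact)
    have \<kappa>B: "(\<lambda>\<omega>. measure (?\<kappa> \<omega>) B) \<in> borel_measurable ?G"
      by (rule measurable_compose[OF \<kappa>]) simp
    then show "(\<lambda>\<omega>. measure (?\<kappa> \<omega>) B) \<in> borel_measurable ?G" .
    have \<kappa>BP: "(\<lambda>\<omega>. measure (?\<kappa> \<omega>) B) \<in> borel_measurable P"
      by (rule measurable_from_subalg[OF sub \<kappa>B])
    show "integrable P (\<lambda>\<omega>. measure (?\<kappa> \<omega>) B)"
      using \<kappa>BP by (intro integrable_const_bound[where B = 1]) auto
    have event: "state_at (n + 1) -` B \<inter> space P \<in> events"
      by (rule measurable_sets[OF measurable_state_at]) simp
    then show "integrable P (indicator (state_at (n + 1) -` B \<inter> space P) :: 'w \<Rightarrow> real)"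
      by (simp add: emeasure_eq_measure)
    have version: "AE \<omega> in P. measure (?\<kappa> \<omega>) B = unif_compatible (n + 1) B \<omega>"
      using past_map_eq_compatible[OF coin_tossing_\<eta> assms(4), of n]
      by eventually_elim (simp add: \<eta>_def unif_compatible_def)
    fix A assume "A \<in> sets ?G"
    then obtain C where C: "C \<in> sets sequence_space" "A = ?Z -` C \<inter> space P"
      using measurable_space[OF Z] by (auto simp: sets_vimage_algebra2)
    have ind: "(\<lambda>\<omega>. indicator C (?Z \<omega>) :: real) \<in> borel_measurable P"
      by (rule measurable_compose[OF Z]) (use C(1) in simp)
    have "(\<integral>\<omega>\<in>A. indicator (state_at (n + 1) -` B \<inter> space P) \<omega> \<partial>P :: real) =
        (\<integral>\<omega>. indicator B (state_at (n + 1) \<omega>) * indicator C (\<lambda>j. \<eta> j \<omega>) \<partial>P)"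
      unfolding set_lebesgue_integral_def
      by (rule Bochner_Integration.integral_cong) (auto simp: C(2) Z_eq indicator_def)
    also have "\<dots> = (\<integral>\<omega>. unif_compatible (n + 1) B \<omega> * indicator C (\<lambda>j. \<eta> j \<omega>) \<partial>P)"
      using integral_gap_cylinder[of "n + 1" B]
      by (intro set_integral_eqI_cylinders[OF prob_space_axioms Z[unfolded Z_eq]] C(1)
          measurable_indicator_state_at measurable_unif_compatible)
        (auto simp: gap_def unif_compatible_def indicator_def)
    also have "\<dots> = (\<integral>\<omega>. measure (?\<kappa> \<omega>) B * indicator C (?Z \<omega>) \<partial>P)"
      by (rule integral_cong_AE)
        (use version ind \<kappa>BP measurable_unif_compatible in
          \<open>auto simp: Z_at intro!: borel_measurable_times\<close>)
    also have "\<dots> = (\<integral>\<omega>\<in>A. measure (?\<kappa> \<omega>) B \<partial>P)"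
      unfolding set_lebesgue_integral_def
      by (rule Bochner_Integration.integral_cong) (auto simp: C(2) indicator_def)
    finally show "(\<integral>\<omega>\<in>A. indicator (state_at (n + 1) -` B \<inter> space P) \<omega> \<partial>P) =
        (\<integral>\<omega>\<in>A. measure (?\<kappa> \<omega>) B \<partial>P)" .
  qed
  then show ?thesis
    unfolding cond_law_def Y_eq using measurable_state_at Z \<kappa> by blast
qed

end
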